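(* Let $G$ be a (non-random) connected graph with maximum degree at most $3$. Suppose that the edge weights $(w_e)_{e\in E(G)}$ are i.i.d. exponential random variables with mean $1$. Let $e\in E(G)$. Then for any integer $r\ge 1$ and any $\varepsilon\in(0,1)$, $$\varrho_r(G,e)\;\le\; 6\bigl((1-\varepsilon)^r+\varepsilon\bigr).$$ In particular (taking $\varepsilon=\log r/r$), $$\varrho_r(G,e)\;\le\;\frac{18\log r}{r}\qquad\text{for all } r\ge 2.$$
   Context: A graph $G=(V(G),E(G))$ is undirected, with edges $(uv)$ being unordered pairs of distinct vertices; it may be finite or infinite. For $u,v\in V(G)$, $u\sim_G v$ means $(uv)\in E(G)$. A matching of a graph is a set of edges no two of which share a vertex. For a finite graph $H$ with edge weights $(w_e)$, the weight of a matching $M$ is $w_M=\sum_{e\in M}w_e$, and $\mathsf{M}_H$ denotes the maximum weight matching (the matching of $H$ maximizing $w_M$), which is almost surely unique for i.i.d. weights from a continuous distribution. Subgraphs of $G$ inherit the edge weights of $G$. For an edge $e=(uv)$ of $G$ and $r\ge 0$, $\mathbb{B}_e^r(G)$ is the subgraph of $G$ induced by all vertices whose graph distance (in $G$) from $u$ or from $v$ is at most $r$. For a subgraph $H$ of $G$, its boundary is $\partial H=\{v\in V(H): v\sim_G u \text{ for some } u\in V(G)\setminus V(H)\}$. For $A\subseteq V(H)$, $H\setminus A$ is the induced subgraph of $H$ on $V(H)\setminus A$. For a locally finite connected graph $G$, $e\in E(G)$ and $r\ge1$, define $$\varrho_r(G,e)=\mathbf{E}\sup_{A\subseteq \partial \mathbb{B}_e^r(G)}\bigl|\mathbf{1}_{\{e\in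 \mathsf{M}_{\mathbb{B}_e^r(G)}\}}-\mathbf{1}_{\{e\in \mathsf{M}_{\mathbb{B}_e^r(G)\setminus A}\}}\bigr|,$$ where the expectation is over the edge weights. *)

theory Defs
  imports "HOL-Probability.Probability" "HOL-Library.Extended_Nat"
begin

text \<open>Undirected simple graphs, finite or infinite; an edge is a two-element set of vertices.\<close>

record 'a ugraph =
  verts :: "'a set"
  edges :: "'a set set"

definition is_graph :: "'a ugraph \<Rightarrow> bool" where
  "is_graph G \<longleftrightarrow> (\<forall>e\<in>edges G. \<exists>u\<in>verts G. \<exists>v\<in>verts G. u \<noteq> v \<and> e = {u, v})"

definition adj :: "'a ugraph \<Rightarrow> 'a \<Rightarrow> 'a \<Rightarrow> bool" where
  "adj G u v \<longleftrightarrow> {u, v} \<in> edges G"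

definition neighbors :: "'a ugraph \<Rightarrow> 'a \<Rightarrow> 'a set" where
  "neighbors G v = {u \<in> verts G. adj G v u}"

text \<open>Finiteness is required separately, since \<open>card\<close> of an infinite set is \<open>0\<close>.\<close>

definition max_degree_le :: "'a ugraph \<Rightarrow> nat \<Rightarrow> bool" where
  "max_degree_le G d \<longleftrightarrow> (\<forall>v\<in>verts G. finite (neighbors G v) \<and> card (neighbors G v) \<le> d)"

definition is_walk :: "'a ugraph \<Rightarrow> 'a \<Rightarrow> 'a list \<Rightarrow> 'a \<Rightarrow> bool" where
  "is_walk G u p v \<longleftrightarrow>
     p \<noteq> [] \<and> hd p = u \<and> last p = v \<and> set p \<subseteq> verts G \<and> successively (adj G) p"

definition connected_graph :: "'a ugraph \<Rightarrow> bool" where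
  "connected_graph G \<longleftrightarrow> (\<forall>u\<in>verts G. \<forall>v\<in>verts G. \<exists>p. is_walk G u p v)"

text \<open>A walk is a list of vertices, so its length as a walk is one less than its length as a list.
  The infimum over no walks is \<open>\<infinity>\<close>.\<close>

definition graph_dist :: "'a ugraph \<Rightarrow> 'a \<Rightarrow> 'a \<Rightarrow> enat" where
  "graph_dist G u v = (INF p\<in>{p. is_walk G u p v}. enat (length p - 1))"

definition induced_subgraph :: "'a ugraph \<Rightarrow> 'a set \<Rightarrow> 'a ugraph" where
  "induced_subgraph G S = \<lparr>verts = verts G \<inter> S, edges = {e \<in> edges G. e \<subseteq> S}\<rparr>"

definition edge_ball :: "'a ugraph \<Rightarrow> 'a set \<Rightarrow> nat \<Rightarrow> 'a ugraph" where
  "edge_ball G e r =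
     induced_subgraph G {x \<in> verts G. \<exists>u\<in>e. graph_dist G u x \<le> enat r}"

definition boundary :: "'a ugraph \<Rightarrow> 'a ugraph \<Rightarrow> 'a set" where
  "boundary G H = {v \<in> verts H. \<exists>u \<in> verts G - verts H. adj G v u}"

definition delete_verts :: "'a ugraph \<Rightarrow> 'a set \<Rightarrow> 'a ugraph" where
  "delete_verts H A = induced_subgraph H (verts H - A)"

definition matchings :: "'a ugraph \<Rightarrow> 'a set set set" where
  "matchings H = {M. M \<subseteq> edges H \<and> disjoint M}"

text \<open>For a finite graph a maximizer exists; \<^const>\<open>arg_max_on\<close> picks one of them. The pick depends
  on the weights only through the (finite) set of maximizers, and it matters only on the null event
  that the maximizer is not unique.\<close>

definition max_weight_matching :: "'a ugraph \<Rightarrow> ('a set \<Rightarrow> real) \<Rightarrow> 'a set set" where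
  "max_weight_matching H w = arg_max_on (\<lambda>M. \<Sum>e\<in>M. w e) (matchings H)"

text \<open>The edge weights are random variables \<open>w e\<close> on a probability space \<open>P\<close>; the boundary is
  that of the ball in the whole graph \<open>G\<close>.\<close>

definition rho ::
  "'b measure \<Rightarrow> ('a set \<Rightarrow> 'b \<Rightarrow> real) \<Rightarrow> 'a ugraph \<Rightarrow> 'a set \<Rightarrow> nat \<Rightarrow> real" where
  "rho P w G e r =
     prob_space.expectation P (\<lambda>\<omega>.
       SUP A\<in>Pow (boundary G (edge_ball G e r)).
         \<bar>of_bool (e \<in> max_weight_matching (edge_ball G e r) (\<lambda>f. w f \<omega>))
           - of_bool (e \<in> max_weight_matching (delete_verts (edge_ball G e r) A) (\<lambda>f. w f \<omega>))\<bar>)"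

end

theory Submission
  imports Defs
begin

text \<open>
  Let M(F) be the maximum weight of a matching of the finite edge set F, and let
  p(F, v) = exp (M(F - v) - M(F)). An optimal matching uses at most one edge at v, so
  p(F, v) is the minimum of 1 and of U(vx) / p(F - v, x) over the neighbours x of v, where
  U(f) = exp (- w f) is uniform on [0, 1]. This recursion is exact on every graph and antitone in
  its inputs. Starting it at depth r from the extreme values 0 and 1 gives random bounds
  l \<le> p \<le> h which hold simultaneously for all graphs obtained by deleting vertices at distance r.
  The edge e = ab lies in the maximum matching iff U(e) is below a product of two such quantities
  not depending on U(e), so its status can depend on the deleted set only if U(e) falls between
  two products, which has probability at most twice the largest expected gap h - l at depth r.

  It remains to contract the gap. After e is removed, at most two children x, y matter at every step.
  Averaging over the two edges at v turns the minimum into 1 - (p + q)/2 + p q/3, so the expected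
  gap drops from the mean of the children's gaps by a third of E (h_x h_y - l_x l_y), which is at least
  E ((h_x - l_x) h_y + (h_y - l_y) h_x)/2. The children are not independent, but h_y is at least
  the minimum of two uniform variables, whence E (c - h_y)^+ \<le> c^2 and
  E ((h_x - l_x) h_y) \<ge> c E (h_x - l_x) - c^2. With c = 3 \<epsilon> the gap D_n satisfies
  D_(n+1) \<le> (1 - \<epsilon>) D_n + 3 \<epsilon>^2, so D_n \<le> (1 - \<epsilon>)^n + 3 \<epsilon>.
\<close>

section \<open>The cavity recursion for maximum weight matchings\<close>

text \<open>Graphs enter the recursion as bare finite edge sets: isolated vertices do not matter for
  matchings, and deleting vertices becomes \<open>edges_avoiding\<close>.\<close>

definition simple_edges :: "'a set set \<Rightarrow> bool" where
  "simple_edges F \<longleftrightarrow> finite F \<and> (\<forall>f\<in>F. \<exists>a b. a \<noteq> b \<and> f = {a, b})"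

definition edges_avoiding :: "'a set \<Rightarrow> 'a set set \<Rightarrow> 'a set set" where
  "edges_avoiding A F = {f \<in> F. f \<inter> A = {}}"

definition nbrs :: "'a set set \<Rightarrow> 'a \<Rightarrow> 'a set" where
  "nbrs F v = {x. {v, x} \<in> F}"

definition match_sets :: "'a set set \<Rightarrow> 'a set set set" where
  "match_sets F = {M. M \<subseteq> F \<and> disjoint M}"

definition max_weight :: "('a set \<Rightarrow> real) \<Rightarrow> 'a set set \<Rightarrow> real" where
  "max_weight w F = Max (sum w ` match_sets F)"

definition cavity :: "('a set \<Rightarrow> real) \<Rightarrow> 'a set set \<Rightarrow> 'a \<Rightarrow> real" where
  "cavity w F v = exp (max_weight w (edges_avoiding {v} F) - max_weight w F)"

text \<open>This is min 1 (u / p) for p > 0 and u \<ge> 0; the value at p = 0 is 1, as if u / 0 were infinite,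
  and clipping at 0 keeps the value in [0, 1] for all real u.\<close>

definition clip_ratio :: "real \<Rightarrow> real \<Rightarrow> real" where
  "clip_ratio p u = (if p \<le> u then 1 else max 0 (u / p))"

text \<open>The Boolean selects the upper (True) or lower (False) bound; it alternates along the recursion
  because clip_ratio is antitone in its first argument.\<close>

primrec cavity_bound :: "nat \<Rightarrow> bool \<Rightarrow> 'a set set \<Rightarrow> 'a \<Rightarrow> ('a set \<Rightarrow> real) \<Rightarrow> real" where
  "cavity_bound 0 b F v U = of_bool b"
| "cavity_bound (Suc n) b F v U =
     Min (insert 1 ((\<lambda>x. clip_ratio (cavity_bound n (\<not> b) (edges_avoiding {v} F) x U) (U {v, x})) ` nbrs F v))"

section \<open>Edge deletion and maximum weights\<close>

lemma simple_edges_subset: "simple_edges F \<Longrightarrow> F' \<subseteq> F \<Longrightarrow> simple_edges F'"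
  unfolding simple_edges_def by (meson finite_subset subset_iff)

lemma simple_edges_finite: "simple_edges F \<Longrightarrow> finite F"
  by (simp add: simple_edges_def)

lemma edges_avoiding_subset: "edges_avoiding A F \<subseteq> F"
  by (auto simp: edges_avoiding_def)

lemma simple_edges_avoiding: "simple_edges F \<Longrightarrow> simple_edges (edges_avoiding A F)"
  by (rule simple_edges_subset[OF _ edges_avoiding_subset])

lemma edges_avoiding_avoiding: "edges_avoiding A (edges_avoiding B F) = edges_avoiding (A \<union> B) F"
  by (auto simp: edges_avoiding_def)

lemma nbrs_mono: "F' \<subseteq> F \<Longrightarrow> nbrs F' v \<subseteq> nbrs F v"
  by (auto simp: nbrs_def)

lemma finite_nbrs:
  assumes "finite F" shows "finite (nbrs F v)"
proof -
  have "(\<lambda>x. {v, x}) ` nbrs F v \<subseteq> F"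
    by (auto simp: nbrs_def)
  then have "finite ((\<lambda>x. {v, x}) ` nbrs F v)"
    using assms finite_subset by blast
  moreover have "inj_on (\<lambda>x. {v, x}) (nbrs F v)"
    by (auto simp: inj_on_def doubleton_eq_iff)
  ultimately show ?thesis
    by (rule finite_imageD)
qed

lemma finite_match_sets: "finite F \<Longrightarrow> finite (match_sets F)"
  unfolding match_sets_def by (rule finite_subset[of _ "Pow F"]) auto

lemma empty_in_match_sets: "{} \<in> match_sets F"
  by (auto simp: match_sets_def)

lemma max_weight_ge: "finite F \<Longrightarrow> M \<in> match_sets F \<Longrightarrow> sum w M \<le> max_weight w F"
  unfolding max_weight_def by (simp add: finite_match_sets)

lemma max_weight_obtain:
  assumes "finite F" obtains M where "M \<in> match_sets F" "max_weight w F = sum w M"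
proof -
  have "max_weight w F \<in> sum w ` match_sets F"
    unfolding max_weight_def using assms empty_in_match_sets
    by (intro Max_in finite_imageI finite_match_sets) auto
  with that show ?thesis by auto
qed

lemma max_weight_mono:
  assumes "finite F" "F' \<subseteq> F" shows "max_weight w F' \<le> max_weight w F"
proof -
  obtain M where "M \<in> match_sets F'" "max_weight w F' = sum w M"
    using assms finite_subset max_weight_obtain by metis
  with assms show ?thesis
    by (auto intro!: max_weight_ge simp: match_sets_def)
qed

lemma match_sets_insert:
  assumes "f \<in> F" "M \<in> match_sets (edges_avoiding f F)"
  shows "insert f M \<in> match_sets F"
  using assms by (auto simp: match_sets_def edges_avoiding_def disjnt_def pairwise_insert)

lemma match_sets_remove:
  assumes "M \<in> match_sets F" "f \<in> M"
  shows "M - {f} \<in> match_sets (edges_avoiding f F)"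
  using assms by (auto simp: match_sets_def edges_avoiding_def disjnt_def pairwise_def)

text \<open>Adding \<open>f\<close> to an optimal matching of the edges disjoint from
  \<open>f\<close> gives a matching of \<open>F\<close>.\<close>

lemma max_weight_edge_le:
  assumes "simple_edges F" "f \<in> F"
  shows "w f + max_weight w (edges_avoiding f F) \<le> max_weight w F"
proof -
  have fin: "finite F" "finite (edges_avoiding f F)" 
    using assms by (simp_all add: simple_edges_finite simple_edges_avoiding)
  obtain M where M: "M \<in> match_sets (edges_avoiding f F)" "max_weight w (edges_avoiding f F) = sum w M"
    using fin max_weight_obtain by metis
  \<comment> \<open>An empty \<open>f\<close> would itself survive in
    \<open>edges_avoiding f F\<close>, so inserting it might add no weight.\<close>
  have "f \<noteq> {}" using assms by (auto simp: simple_edges_def)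
  then have "f \<notin> M" "finite M"
    using M fin by (auto simp: match_sets_def edges_avoiding_def dest: finite_subset)
  then have "sum w (insert f M) = w f + max_weight w (edges_avoiding f F)"
    using M by simp
  with max_weight_ge[OF fin(1) match_sets_insert[OF assms(2) M(1)], of w] show ?thesis by simp
qed

text \<open>The rest of a matching through \<open>f\<close> is disjoint from \<open>f\<close>.
  Together with \<open>max_weight_edge_le\<close> this gives the optimum over all matchings that use
  \<open>f\<close>.\<close>

lemma sum_match_le:
  assumes "simple_edges F" "M \<in> match_sets F" "f \<in> M"
  shows "sum w M \<le> w f + max_weight w (edges_avoiding f F)"
proof -
  have fin: "finite F" "finite (edges_avoiding f F)" 
    using assms by (simp_all add: simple_edges_finite simple_edges_avoiding)
  have "sum w M = w f + sum w (M - {f})"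
    using assms fin finite_subset by (intro sum.remove) (auto simp: match_sets_def)
  with max_weight_ge[OF fin(2) match_sets_remove[OF assms(2,3)], of w] show ?thesis by simp
qed

section \<open>The ratio function and the exact recursion\<close>

lemma cavity_pos: "0 < cavity w F v"
  by (simp add: cavity_def)

lemma cavity_le_1: "finite F \<Longrightarrow> cavity w F v \<le> 1"
  using max_weight_mono[OF _ edges_avoiding_subset, of F w] by (simp add: cavity_def)

lemma clip_ratio_nonneg: "0 \<le> clip_ratio p u"
  by (simp add: clip_ratio_def)

lemma clip_ratio_le_1: "0 \<le> p \<Longrightarrow> clip_ratio p u \<le> 1"
  by (auto simp: clip_ratio_def divide_le_eq)

lemma clip_ratio_antimono:
  assumes "0 \<le> p" "p \<le> q" shows "clip_ratio q u \<le> clip_ratio p u"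
\<comment> \<open>Outside 0 < u < p the claim follows from clipping; inside it is monotonicity of
  division.\<close>
proof (cases "u \<le> 0 \<or> p \<le> u")
  case True
  with assms show ?thesis
    by (auto simp: clip_ratio_def divide_le_eq zero_le_divide_iff max_def)
next
  case False
  with assms have "u / q \<le> u / p"
    by (intro divide_left_mono) auto
  with False assms show ?thesis
    by (auto simp: clip_ratio_def)
qed

lemma clip_ratio_eq_min: "0 < p \<Longrightarrow> 0 \<le> u \<Longrightarrow> clip_ratio p u = min 1 (u / p)"
  by (auto simp: clip_ratio_def min_def max_def divide_simps)

text \<open>Dividing a positive \<open>u\<close> by a number in (0, 1] only increases it. This later
  bounds the upper cavity bound from below by uniform variables.\<close>

lemma clip_ratio_ge: "p \<le> 1 \<Longrightarrow> 0 \<le> p \<Longrightarrow> min 1 u \<le> clip_ratio p u"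
proof (cases "u \<le> 0 \<or> p \<le> u")
  case False
  moreover assume "p \<le> 1" "0 \<le> p"
  ultimately have "u \<le> u / p"
    by (simp add: le_divide_eq mult_left_le)
  then show ?thesis
    by (auto simp: clip_ratio_def)
qed (auto simp: clip_ratio_def)

text \<open>The ratio telescopes: it compares the optimum without \<open>v\<close> to the optimum
  among matchings that use the edge \<open>{v, x}\<close>.\<close>

lemma clip_ratio_surv:
  "clip_ratio (cavity w (edges_avoiding {v} F) x) (exp (- w {v, x})) =
     min 1 (exp (max_weight w (edges_avoiding {v} F) - (w {v, x} + max_weight w (edges_avoiding {v, x} F))))"
proof -
  have "exp (- w {v, x}) / cavity w (edges_avoiding {v} F) x =
      exp (max_weight w (edges_avoiding {v} F) - (w {v, x} + max_weight w (edges_avoiding {v, x} F)))"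
    unfolding cavity_def by (simp add: edges_avoiding_avoiding exp_diff[symmetric] insert_commute algebra_simps)
  then show ?thesis
    by (subst clip_ratio_eq_min) (simp_all add: cavity_pos)
qed

text \<open>An optimal matching either leaves v uncovered or uses exactly one edge at v.\<close>

lemma cavity_rec:
  assumes F: "simple_edges F"
  shows "cavity w F v =
    Min (insert 1 ((\<lambda>x. clip_ratio (cavity w (edges_avoiding {v} F) x) (exp (- w {v, x}))) ` nbrs F v))"
    (is "_ = Min ?S")
proof (rule antisym)
  have fin: "finite F" using F by (simp add: simple_edges_def)
  have finS: "finite ?S" using finite_nbrs[OF fin] by simp
  show "cavity w F v \<le> Min ?S"
  proof (subst Min_ge_iff[OF finS], simp, safe)
    fix x assume x: "x \<in> nbrs F v"
    have "w {v, x} + max_weight w (edges_avoiding {v, x} F) \<le> max_weight w F"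
      using x by (intro max_weight_edge_le F) (simp add: nbrs_def)
    then show "cavity w F v \<le> clip_ratio (cavity w (edges_avoiding {v} F) x) (exp (- w {v, x}))"
      unfolding clip_ratio_surv using cavity_le_1[OF fin, of w v] by (simp add: cavity_def)
  qed (rule cavity_le_1[OF fin])
  show "Min ?S \<le> cavity w F v"
  proof (subst Min_le_iff[OF finS], simp)
    obtain M where M: "M \<in> match_sets F" "max_weight w F = sum w M"
      using fin max_weight_obtain by metis
    show "\<exists>s\<in>?S. s \<le> cavity w F v"
    proof (cases "\<exists>f\<in>M. v \<in> f")
      case True
      then obtain f where f: "f \<in> M" "v \<in> f" by blast
      then have "f \<in> F" using M by (auto simp: match_sets_def)
      then obtain x where x: "f = {v, x}"
        using F f unfolding simple_edges_def by (metis doubleton_eq_iff insertE singletonD)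
      have "max_weight w F \<le> w {v, x} + max_weight w (edges_avoiding {v, x} F)"
        using sum_match_le[OF F M(1) f(1), of w] M(2) x by simp
      then have "clip_ratio (cavity w (edges_avoiding {v} F) x) (exp (- w {v, x})) \<le> cavity w F v"
        unfolding clip_ratio_surv by (simp add: cavity_def min_le_iff_disj)
      moreover have "x \<in> nbrs F v" using x \<open>f \<in> F\<close> by (simp add: nbrs_def)
      ultimately show ?thesis by blast
    next
      case False
      then have "M \<in> match_sets (edges_avoiding {v} F)" using M by (auto simp: match_sets_def edges_avoiding_def)
      then have "max_weight w F \<le> max_weight w (edges_avoiding {v} F)"
        using M(2) max_weight_ge finite_subset[OF edges_avoiding_subset fin] by metis
      then show ?thesis by (auto simp: cavity_def)
    qed
  qed
qed

section \<open>Truncated bounds and the sandwich\<close>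

lemma cavity_bound_bounds:
  assumes "finite F" shows "0 \<le> cavity_bound n b F v U \<and> cavity_bound n b F v U \<le> 1"
  using assms
proof (cases n)
  case (Suc m)
  with assms show ?thesis
    by (auto simp: finite_nbrs clip_ratio_nonneg)
qed simp

text \<open>By antitonicity of \<open>clip_ratio\<close>: at level \<open>Suc n\<close> the lower
  bound is built from the upper bounds of the children, and conversely.\<close>

lemma cavity_bound_mono:
  assumes "finite F" shows "cavity_bound n False F v U \<le> cavity_bound n True F v U"
  using assms
proof (induction n arbitrary: F v)
  case (Suc n)
  have fd: "finite (edges_avoiding {v} F)" by (rule finite_subset[OF edges_avoiding_subset Suc.prems])
  have "Min (insert 1 ((\<lambda>x. clip_ratio (cavity_bound n True (edges_avoiding {v} F) x U) (U {v, x})) ` nbrs F v))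
    \<le> clip_ratio (cavity_bound n False (edges_avoiding {v} F) x U) (U {v, x})" if x: "x \<in> nbrs F v" for x
  proof (rule order_trans[OF Min_le])
    show "clip_ratio (cavity_bound n True (edges_avoiding {v} F) x U) (U {v, x})
      \<le> clip_ratio (cavity_bound n False (edges_avoiding {v} F) x U) (U {v, x})"
      using Suc.IH[OF fd] cavity_bound_bounds[OF fd] by (intro clip_ratio_antimono) auto
  qed (use x finite_nbrs[OF Suc.prems] in auto)
  then show ?case
    using finite_nbrs[OF Suc.prems] by (auto simp: Min_ge_iff)
qed simp

text \<open>Locality is the source of all independence used below: resampling an edge outside
  \<open>F\<close> leaves the bounds on \<open>F\<close> unchanged.\<close>

lemma cavity_bound_cong:
  assumes "\<And>f. f \<in> F \<Longrightarrow> U f = U' f" shows "cavity_bound n b F v U = cavity_bound n b F v U'"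
  using assms
proof (induction n arbitrary: b F v)
  case (Suc n)
  have "cavity_bound n (\<not> b) (edges_avoiding {v} F) x U = cavity_bound n (\<not> b) (edges_avoiding {v} F) x U'" for x
    using Suc.prems edges_avoiding_subset by (intro Suc.IH) blast
  moreover have "U {v, x} = U' {v, x}" if "x \<in> nbrs F v" for x
    using that Suc.prems by (simp add: nbrs_def)
  ultimately show ?case by (simp cong: image_cong)
qed simp

text \<open>In the application B k is the ball of radius k around e and A is a set of vertices at distance r.
  A child lying in A is missing from the recursion for the graph without A; this happens only at
  depth n = 0, where the lower bound 0 of the child yields the harmless ratio 1.\<close>

lemma cavity_sandwich:
  fixes B :: "nat \<Rightarrow> 'a set" and w :: "'a set \<Rightarrow> real"
  assumes "simple_edges F"
    and "\<And>k. k < r \<Longrightarrow> A \<inter> B k = {}"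
    and "\<And>k x y. x \<in> B k \<Longrightarrow> {x, y} \<in> F \<Longrightarrow> y \<in> B (Suc k)"
    and "v \<in> B k" and "k + n \<le> r"
  shows "cavity_bound n False F v (\<lambda>f. exp (- w f)) \<le> cavity w (edges_avoiding A F) v \<and>
    cavity w (edges_avoiding A F) v \<le> cavity_bound n True F v (\<lambda>f. exp (- w f))"
  using assms
proof (induction n arbitrary: F v k)
  case 0
  then have "finite (edges_avoiding A F)" using simple_edges_avoiding simple_edges_def by blast
  then show ?case using cavity_pos[of w "edges_avoiding A F" v] cavity_le_1[of "edges_avoiding A F" w v] by simp
next
  case (Suc n)
  let ?U = "\<lambda>f. exp (- w f)"
  let ?D = "edges_avoiding {v} F"
  let ?c = "\<lambda>x. clip_ratio (cavity w (edges_avoiding A ?D) x) (?U {v, x})"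
  have fin: "finite F" "finite ?D" "finite (edges_avoiding A ?D)"
    using Suc.prems(1) by (simp_all add: simple_edges_finite simple_edges_avoiding)
  \<comment> \<open>The depth is \<open>Suc n\<close>, so \<open>k + Suc n \<le> r\<close> forces
    \<open>k < r\<close>.\<close>
  have "v \<notin> A" using Suc.prems(2)[of k] Suc.prems(4,5) by auto
  then have nbA: "nbrs (edges_avoiding A F) v = nbrs F v - A" by (auto simp: nbrs_def edges_avoiding_def)
  have rec: "cavity w (edges_avoiding A F) v = Min (insert 1 (?c ` (nbrs F v - A)))"
    using cavity_rec[OF simple_edges_avoiding[OF Suc.prems(1)], of w A v]
    by (simp add: nbA edges_avoiding_avoiding Un_commute insert_commute)
  have IH: "cavity_bound n False ?D x ?U \<le> cavity w (edges_avoiding A ?D) x \<and>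
      cavity w (edges_avoiding A ?D) x \<le> cavity_bound n True ?D x ?U" if "x \<in> nbrs F v" for x
  proof (rule Suc.IH)
    show "simple_edges ?D" by (rule simple_edges_avoiding[OF Suc.prems(1)])
    show "A \<inter> B k = {}" if "k < r" for k using Suc.prems(2) that .
    show "y \<in> B (Suc k)" if "x \<in> B k" "{x, y} \<in> ?D" for k x y
      using Suc.prems(3) that edges_avoiding_subset by blast
    show "x \<in> B (Suc k)" using that Suc.prems(3,4) by (auto simp: nbrs_def)
    show "Suc k + n \<le> r" using Suc.prems(5) by simp
  qed
  \<comment> \<open>Shown for all neighbours in \<open>F\<close>, while the minimum in
    \<open>rec\<close> omits those in \<open>A\<close>: dropping children only raises a minimum, so
    the lower bound is safe. Only the upper bound needs a case distinction.\<close>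
  have lower: "cavity_bound (Suc n) False F v ?U \<le> ?c x" if x: "x \<in> nbrs F v" for x
  proof -
    have "cavity_bound (Suc n) False F v ?U \<le> clip_ratio (cavity_bound n True ?D x ?U) (?U {v, x})"
      using x finite_nbrs[OF fin(1)] by (simp add: Min_le)
    also have "\<dots> \<le> ?c x"
      using IH[OF x] by (intro clip_ratio_antimono less_imp_le[OF cavity_pos]) simp
    finally show ?thesis .
  qed
  have upper: "cavity w (edges_avoiding A F) v \<le> clip_ratio (cavity_bound n False ?D x ?U) (?U {v, x})"
    if x: "x \<in> nbrs F v" for x
  proof (cases "x \<in> A")
    case True
    have "x \<in> B (Suc k)" using x Suc.prems(3,4) by (auto simp: nbrs_def)
    then have "n = 0" using True Suc.prems(2)[of "Suc k"] Suc.prems(5) by fastforce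
    then show ?thesis
      using cavity_le_1[OF finite_subset[OF edges_avoiding_subset fin(1)]] by (simp add: clip_ratio_def)
  next
    case False
    then have "cavity w (edges_avoiding A F) v \<le> ?c x"
      unfolding rec using x finite_nbrs[OF fin(1)] by (intro Min_le) auto
    also have "\<dots> \<le> clip_ratio (cavity_bound n False ?D x ?U) (?U {v, x})"
      using IH[OF x] cavity_bound_bounds[OF fin(2)] by (intro clip_ratio_antimono) auto
    finally show ?thesis .
  qed
  show ?case
  proof
    show "cavity_bound (Suc n) False F v ?U \<le> cavity w (edges_avoiding A F) v"
      unfolding rec
      using lower finite_nbrs[OF fin(1)] cavity_bound_bounds[OF fin(1), of "Suc n" False v ?U]
      by (subst Min_ge_iff) auto
    show "cavity w (edges_avoiding A F) v \<le> cavity_bound (Suc n) True F v ?U"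
      using upper finite_nbrs[OF fin(1)] cavity_le_1[OF finite_subset[OF edges_avoiding_subset fin(1)]]
      by (subst cavity_bound.simps, subst Min_ge_iff) auto
  qed
qed

section \<open>Membership of an edge in the optimal matching\<close>

lemma max_weight_matching_optimal:
  assumes "finite (edges H)"
  shows "max_weight_matching H w \<in> match_sets (edges H)"
    and "sum w (max_weight_matching H w) = max_weight w (edges H)"
proof -
  obtain M where M: "M \<in> match_sets (edges H)" "max_weight w (edges H) = sum w M"
    using assms max_weight_obtain by metis
  have "is_arg_max (sum w) (\<lambda>x. x \<in> matchings H) M"
    using M max_weight_ge[OF assms, of _ w]
    by (auto simp: is_arg_max_linorder matchings_def match_sets_def)
  \<comment> \<open>\<open>arg_max_on\<close> is a choice operator; since a maximizer exists, the
    chosen set is one.\<close>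
  then have "is_arg_max (sum w) (\<lambda>x. x \<in> matchings H) (max_weight_matching H w)"
    unfolding max_weight_matching_def arg_max_on_def arg_max_def by (rule someI)
  then have *: "max_weight_matching H w \<in> match_sets (edges H)"
    "sum w M \<le> sum w (max_weight_matching H w)"
    using M by (auto simp: is_arg_max_linorder matchings_def match_sets_def)
  show "max_weight_matching H w \<in> match_sets (edges H)" by (fact *)
  show "sum w (max_weight_matching H w) = max_weight w (edges H)"
    using * M max_weight_ge[OF assms *(1), of w] by simp
qed

text \<open>Ties are left open: then the choice made by arg_max_on is unspecified.\<close>

lemma edge_in_max_weight_matching:
  fixes w :: "'a set \<Rightarrow> real"
  assumes E: "simple_edges (edges H)" and e: "e = {a, b}" "a \<noteq> b" "e \<in> edges H"
  defines "F \<equiv> edges H - {e}"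
  defines "p \<equiv> cavity w F a * cavity w (edges_avoiding {a} F) b"
  shows "exp (- w e) < p \<Longrightarrow> e \<in> max_weight_matching H w"
    and "p < exp (- w e) \<Longrightarrow> e \<notin> max_weight_matching H w"
proof -
  let ?M = "max_weight_matching H w"
  have fin: "finite (edges H)" using E by (simp add: simple_edges_def)
  have eqd: "edges_avoiding e (edges H) = edges_avoiding {a, b} F" by (auto simp: edges_avoiding_def F_def e)
  \<comment> \<open>The two factors telescope, so comparing \<open>exp (- w e)\<close> with
    \<open>p\<close> means comparing the best matching with \<open>e\<close> to the best one without
    it.\<close>
  have p: "p = exp (max_weight w (edges_avoiding {a, b} F) - max_weight w F)"
    unfolding p_def cavity_def by (simp add: edges_avoiding_avoiding exp_add[symmetric] insert_commute)
  note opt = max_weight_matching_optimal[OF fin, of w]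
  show "e \<in> ?M" if "exp (- w e) < p"
  proof (rule ccontr)
    assume "e \<notin> ?M"
    then have "?M \<in> match_sets F" using opt(1) by (auto simp: match_sets_def F_def)
    then have "sum w ?M \<le> max_weight w F" using fin by (intro max_weight_ge) (simp_all add: F_def)
    with max_weight_edge_le[OF E e(3), of w] that opt(2) show False by (simp add: p eqd)
  qed
  show "e \<notin> ?M" if "p < exp (- w e)"
  proof
    assume "e \<in> ?M"
    from sum_match_le[OF E opt(1) this, of w] that opt(2) max_weight_mono[OF fin, of F w]
    show False by (simp add: p eqd F_def)
  qed
qed

section \<open>Independent uniform variables\<close>

abbreviation unif :: "real measure" where
  "unif \<equiv> uniform_measure lborel {0..1}"

lemma prob_space_unif: "prob_space unif"
  by (rule prob_space_uniform_measure) auto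

text \<open>Passes to the gauge integral on [0, 1], where the fundamental theorem of calculus gives
  explicit values; the bound \<open>B\<close> supplies integrability.\<close>

lemma integral_unif:
  fixes f :: "real \<Rightarrow> real"
  assumes f: "f \<in> borel_measurable borel" "\<And>u. \<bar>f u\<bar> \<le> B" and I: "(f has_integral I) {0..1}"
  shows "integral\<^sup>L unif f = I"
proof -
  interpret prob_space unif by (rule prob_space_unif)
  have f': "f \<in> borel_measurable lborel" using f by simp
  have eq: "unif = density lborel (\<lambda>x. ennreal (indicator {0..1} x))"
    unfolding uniform_measure_def
    by (rule density_cong) (auto split: split_indicator)
  have "integrable unif f"
    using f by (intro integrable_const_bound[of _ B]) auto
  then have int: "set_integrable lborel {0..1} f"
    unfolding eq set_integrable_def using f' by (subst (asm) integrable_density) auto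
  have "integral\<^sup>L unif f = (LINT x:{0..1}|lborel. f x)"
    unfolding eq set_lebesgue_integral_def using f' by (subst integral_density) auto
  also have "\<dots> = integral {0..1} f"
    by (rule set_borel_integral_eq_integral(2)[OF int])
  finally show ?thesis using I by (simp add: integral_unique)
qed

text \<open>The integrands below follow an elementary function up to a threshold \<open>t\<close>
  and are constant beyond it.\<close>

lemma has_integral_split:
  fixes f :: "real \<Rightarrow> real"
  assumes t: "0 \<le> t" "t \<le> 1"
    and 1: "\<And>u. 0 \<le> u \<Longrightarrow> u \<le> t \<Longrightarrow> f u = g u"
      "\<And>u. (G has_real_derivative g u) (at u)"
    and 2: "\<And>u. t \<le> u \<Longrightarrow> u \<le> 1 \<Longrightarrow> f u = c"
  shows "(f has_integral (G t - G 0 + c * (1 - t))) {0..1}"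
proof (rule has_integral_combine[OF t])
  have "(g has_integral (G t - G 0)) {0..t}"
    using t 1(2) by (intro fundamental_theorem_of_calculus)
      (auto simp: has_real_derivative_iff_has_vector_derivative[symmetric] intro: has_field_derivative_at_within)
  then show "(f has_integral (G t - G 0)) {0..t}"
    by (rule has_integral_eq[rotated]) (use 1(1) in auto)
  have "((\<lambda>_. c) has_integral (c * (1 - t))) {t..1}"
    using t has_integral_const_real[of c t 1] by (simp add: mult.commute)
  then show "(f has_integral (c * (1 - t))) {t..1}"
    by (rule has_integral_eq[rotated]) (use 2 in auto)
qed

lemma clip_ratio_measurable [measurable (raw)]:
  assumes [measurable]: "X \<in> borel_measurable M" "Y \<in> borel_measurable M"
  shows "(\<lambda>x. clip_ratio (X x) (Y x)) \<in> borel_measurable M"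
  unfolding clip_ratio_def by measurable

text \<open>The integrand is u / p up to u = c p and then c. The cap \<open>c\<close> will be the
  ratio contributed by the other child.\<close>

lemma integral_min_clip_ratio:
  assumes p: "0 \<le> p" "p \<le> 1" and c: "0 \<le> c" "c \<le> 1"
  shows "(\<integral>u. min (clip_ratio p u) c \<partial>unif) = c - p * c\<^sup>2 / 2"
proof (rule integral_unif[where B = 1])
  have cp: "c * p \<le> p" using p c by (simp add: mult_left_le_one_le)
  show "((\<lambda>u. min (clip_ratio p u) c) has_integral (c - p * c\<^sup>2 / 2)) {0..1}"
  proof (cases "p = 0")
    case True
    have "((\<lambda>u. min (clip_ratio p u) c) has_integral (c * 0 - c * 0 + c * (1 - 0))) {0..1}"
      by (rule has_integral_split[where g = "\<lambda>_. c" and G = "\<lambda>u. c * u"])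
         (use True c in \<open>auto simp: clip_ratio_def intro!: derivative_eq_intros\<close>)
    with True show ?thesis by simp
  next
    case False
    then have p0: "0 < p" using p by simp
    have "((\<lambda>u. min (clip_ratio p u) c) has_integral
        ((c * p)\<^sup>2 / (2 * p) - 0\<^sup>2 / (2 * p) + c * (1 - c * p))) {0..1}"
    proof (rule has_integral_split[where g = "\<lambda>u. u / p"])
      show "0 \<le> c * p" "c * p \<le> 1" using p c cp by auto
      show "((\<lambda>u. u\<^sup>2 / (2 * p)) has_real_derivative u / p) (at u)" for u
        using p0 by (auto intro!: derivative_eq_intros simp: field_simps)
      show "min (clip_ratio p u) c = u / p" if u: "0 \<le> u" "u \<le> c * p" for u
      proof -
        have "u / p \<le> c" using u p0 by (simp add: pos_divide_le_eq)
        then show ?thesis using u p0 c by (simp add: clip_ratio_eq_min)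
      qed
      show "min (clip_ratio p u) c = c" if u: "c * p \<le> u" "u \<le> 1" for u
      proof -
        have "0 \<le> u" using u p c by (meson mult_nonneg_nonneg order_trans)
        moreover have "c \<le> u / p" using u p0 by (simp add: pos_le_divide_eq)
        ultimately show ?thesis using p0 c by (simp add: clip_ratio_eq_min)
      qed
    qed
    with p0 show ?thesis by (simp add: power2_eq_square algebra_simps)
  qed
  show "\<bar>min (clip_ratio p u) c\<bar> \<le> 1" for u
    using clip_ratio_nonneg[of p u] c by (simp add: min_def)
qed measurable

lemma integral_clip_ratio:
  assumes p: "0 \<le> p" "p \<le> 1"
  shows "(\<integral>u. clip_ratio p u \<partial>unif) = 1 - p / 2"
  using integral_min_clip_ratio[OF p, of 1] clip_ratio_le_1[OF p(1)] by (simp add: min_absorb1)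

text \<open>Averaging over one edge leaves the square of the other ratio, so its second moment is
  needed: p / 3 below the threshold plus 1 - p above.\<close>

lemma integral_clip_ratio_square:
  assumes p: "0 \<le> p" "p \<le> 1"
  shows "(\<integral>u. (clip_ratio p u)\<^sup>2 \<partial>unif) = 1 - 2 * p / 3"
proof (rule integral_unif[where B = 1])
  show "((\<lambda>u. (clip_ratio p u)\<^sup>2) has_integral (1 - 2 * p / 3)) {0..1}"
  proof (cases "p = 0")
    case True
    have "((\<lambda>u. (clip_ratio p u)\<^sup>2) has_integral (0 - 0 + 1 * (1 - 0))) {0..1}"
      by (rule has_integral_split[where g = "\<lambda>_. 1" and G = "\<lambda>u. u"])
         (use True in \<open>auto simp: clip_ratio_def\<close>)
    with True show ?thesis by simp
  next
    case False
    then have p0: "0 < p" using p by simp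
    have "((\<lambda>u. (clip_ratio p u)\<^sup>2) has_integral
        (p ^ 3 / (3 * p\<^sup>2) - 0 ^ 3 / (3 * p\<^sup>2) + 1 * (1 - p))) {0..1}"
    proof (rule has_integral_split[where g = "\<lambda>u. (u / p)\<^sup>2"])
      show "((\<lambda>u. u ^ 3 / (3 * p\<^sup>2)) has_real_derivative (u / p)\<^sup>2) (at u)" for u
        using p0 by (auto intro!: derivative_eq_intros simp: field_simps power2_eq_square)
    qed (use p p0 in \<open>auto simp: clip_ratio_def\<close>)
    with p0 show ?thesis by (simp add: power2_eq_square power3_eq_cube)
  qed
  show "\<bar>(clip_ratio p u)\<^sup>2\<bar> \<le> 1" for u
    using clip_ratio_nonneg[of p u] clip_ratio_le_1[OF p(1), of u] by (simp add: power_le_one)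
qed measurable

text \<open>The cap at 1 is inactive for u in [0, 1]; it bounds the integrand on the whole line, as
  \<open>integral_unif\<close> requires.\<close>

lemma integral_deficit:
  assumes c: "0 \<le> c" "c \<le> 1"
  shows "(\<integral>u. min 1 (max 0 (c - u)) \<partial>unif) = c\<^sup>2 / 2"
proof (rule integral_unif[where B = 1])
  have "((\<lambda>u. min 1 (max 0 (c - u))) has_integral (c * c - c\<^sup>2 / 2 - (c * 0 - 0\<^sup>2 / 2) + 0 * (1 - c))) {0..1}"
  proof (rule has_integral_split[where g = "\<lambda>u. c - u"])
    show "((\<lambda>u. c * u - u\<^sup>2 / 2) has_real_derivative c - u) (at u)" for u
      by (auto intro!: derivative_eq_intros)
  qed (use c in auto)
  then show "((\<lambda>u. min 1 (max 0 (c - u))) has_integral c\<^sup>2 / 2) {0..1}"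
    by (simp add: power2_eq_square)
qed (auto simp: min_def max_def)

lemma integral_between:
  assumes "0 \<le> a" "a \<le> b" "b \<le> 1"
  shows "(\<integral>u. of_bool (a \<le> u \<and> u \<le> b) \<partial>unif) = b - a"
proof -
  have "(\<lambda>u. of_bool (a \<le> u \<and> u \<le> b) :: real) = indicator {a..b}"
    by (auto split: split_indicator)
  moreover have "{0..1} \<inter> {a..b} = {a..b}" using assms by auto
  ultimately show ?thesis using assms by simp
qed

section \<open>Products of uniform variables\<close>

abbreviation unif_prod :: "'i set \<Rightarrow> ('i \<Rightarrow> real) measure" where
  "unif_prod E \<equiv> Pi\<^sub>M E (\<lambda>_. unif)"

lemma prob_space_unif_prod: "prob_space (unif_prod E)"
  by (intro prob_space_PiM prob_space_unif)

lemma integrable_unif_prod: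
  fixes F :: "('i \<Rightarrow> real) \<Rightarrow> real"
  assumes "F \<in> borel_measurable (unif_prod E)" "\<And>U. \<bar>F U\<bar> \<le> B"
  shows "integrable (unif_prod E) F"
proof -
  interpret prob_space "unif_prod E" by (rule prob_space_unif_prod)
  show ?thesis using assms by (intro integrable_const_bound[of _ B]) auto
qed

lemma measurable_coordinate: "f \<in> E \<Longrightarrow> (\<lambda>U. U f) \<in> borel_measurable (unif_prod E)"
  using measurable_component_singleton[of f E "\<lambda>_. unif"] by simp

text \<open>Fubini in the coordinate \<open>f\<close>, with the outer integral kept over all of
  \<open>E\<close>: one product space then serves every step of the recursion.\<close>

lemma resample:
  fixes F :: "('i \<Rightarrow> real) \<Rightarrow> real"
  assumes E: "finite E" "f \<in> E"
    and F: "F \<in> borel_measurable (unif_prod E)" "\<And>U. \<bar>F U\<bar> \<le> B"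
  shows "integral\<^sup>L (unif_prod E) F = (\<integral>U. (\<integral>t. F (U(f := t)) \<partial>unif) \<partial>unif_prod E)"
proof -
  interpret unif: prob_space unif by (rule prob_space_unif)
  interpret product_sigma_finite "\<lambda>_::'i. unif" by standard
  define G where "G U = (\<integral>t. F (U(f := t)) \<partial>unif)" for U
  have upd: "(\<lambda>(U, t). U(f := t)) \<in> measurable (unif_prod E \<Otimes>\<^sub>M unif) (unif_prod E)"
    using measurable_add_dim[of f E "\<lambda>_. unif"] E by (simp add: insert_absorb)
  have "(\<lambda>(U, t). F (U(f := t))) \<in> borel_measurable (unif_prod E \<Otimes>\<^sub>M unif)"
    using measurable_compose[OF upd F(1)] by (simp only: split_def)
  then have Gm: "G \<in> borel_measurable (unif_prod E)"
    unfolding G_def by (rule unif.borel_measurable_lebesgue_integral)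
  have B0: "0 \<le> B" using F(2)[of undefined] by linarith
  have GB: "\<bar>G U\<bar> \<le> B" for U
  \<comment> \<open>A section that fails to be integrable has integral 0 by convention, so the bound
    holds without discussing sections.\<close>
  proof (cases "integrable unif (\<lambda>t. F (U(f := t)))")
    case True
    have "\<bar>G U\<bar> \<le> (\<integral>t. \<bar>F (U(f := t))\<bar> \<partial>unif)"
      unfolding G_def by (rule integral_abs_bound)
    also have "\<dots> \<le> (\<integral>t. B \<partial>unif)"
      using True F(2) by (intro integral_mono) auto
    finally show ?thesis using unif.prob_space by simp
  next
    case False
    then show ?thesis using B0 by (simp add: G_def not_integrable_integral_eq)
  qed
  have "integral\<^sup>L (unif_prod E) F = (\<integral>U. G U \<partial>unif_prod (E - {f}))"
    unfolding G_def using product_integral_insert[of "E - {f}" f F] E integrable_unif_prod[OF F]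
    by (simp add: insert_absorb)
  \<comment> \<open>\<open>G\<close> ignores the coordinate \<open>f\<close>, so putting that
    coordinate back changes nothing.\<close>
  also have "\<dots> = integral\<^sup>L (unif_prod E) G"
    using product_integral_insert[of "E - {f}" f G] E integrable_unif_prod[OF Gm GB] unif.prob_space
    by (simp add: insert_absorb G_def)
  finally show ?thesis by (simp only: G_def[abs_def])
qed

lemma cavity_bound_measurable:
  assumes E: "finite E" and "F \<subseteq> E"
  shows "(\<lambda>U. cavity_bound n b F v U) \<in> borel_measurable (unif_prod E)"
  using assms(2)
proof (induction n arbitrary: b F v)
  case (Suc n)
  have [measurable]: "(\<lambda>U. clip_ratio (cavity_bound n (\<not> b) (edges_avoiding {v} F) x U) (U {v, x}))
      \<in> borel_measurable (unif_prod E)" if "x \<in> nbrs F v" for x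
    using that Suc.prems edges_avoiding_subset[of "{v}" F]
    by (intro clip_ratio_measurable Suc.IH measurable_coordinate) (auto simp: nbrs_def)
  have fin: "finite (nbrs F v)" by (rule finite_nbrs[OF finite_subset[OF Suc.prems E]])
  show ?case
  \<comment> \<open>The term 1 can be split off the minimum only if some neighbour remains, as
    \<open>Min\<close> of the empty set is unspecified.\<close>
  proof (cases "nbrs F v = {}")
    case True
    then have "cavity_bound (Suc n) b F v = (\<lambda>U. 1)"
      by (auto simp: fun_eq_iff)
    then show ?thesis by simp
  next
    case False
    with fin have "cavity_bound (Suc n) b F v = (\<lambda>U. min 1 (Min ((\<lambda>x. clip_ratio
        (cavity_bound n (\<not> b) (edges_avoiding {v} F) x U) (U {v, x})) ` nbrs F v)))"
      by (simp add: fun_eq_iff)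
    moreover have "\<dots> \<in> borel_measurable (unif_prod E)"
      by (intro borel_measurable_min borel_measurable_const borel_measurable_Min fin) measurable
    ultimately show ?thesis by (simp only:)
  qed
next
  case 0
  have "cavity_bound 0 b F v = (\<lambda>U. of_bool b)" by (simp add: fun_eq_iff)
  then show ?case by simp
qed

lemma expect_clip_ratio:
  assumes E: "finite E" "f \<in> E"
    and X: "X \<in> borel_measurable (unif_prod E)" "\<And>U. 0 \<le> X U \<and> X U \<le> 1"
      "\<And>U t. X (U(f := t)) = X U"
  shows "(\<integral>U. clip_ratio (X U) (U f) \<partial>unif_prod E) = (\<integral>U. 1 - X U / 2 \<partial>unif_prod E)"
proof -
  have "(\<integral>U. clip_ratio (X U) (U f) \<partial>unif_prod E)
      = (\<integral>U. (\<integral>t. clip_ratio (X (U(f := t))) ((U(f := t)) f) \<partial>unif) \<partial>unif_prod E)"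
  proof (rule resample[OF E, where B = 1])
    show "(\<lambda>U. clip_ratio (X U) (U f)) \<in> borel_measurable (unif_prod E)"
      using E X(1) by (intro clip_ratio_measurable measurable_coordinate)
    show "\<bar>clip_ratio (X U) (U f)\<bar> \<le> 1" for U
      using X(2)[of U] by (simp add: clip_ratio_nonneg clip_ratio_le_1)
  qed
  also have "\<dots> = (\<integral>U. 1 - X U / 2 \<partial>unif_prod E)"
    using X(2) by (simp add: X(3) integral_clip_ratio)
  finally show ?thesis .
qed

text \<open>Averaging first over \<open>U f\<close> with the other ratio c as cap gives c - X c^2 /
  2; averaging this over \<open>U g\<close> uses the first two moments of c. \<open>X\<close> and
  \<open>Y\<close> may depend on each other, only not on the two coordinates.\<close>

lemma expect_min_clip_ratio:
  assumes E: "finite E" "f \<in> E" "g \<in> E" "f \<noteq> g"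
    and X: "X \<in> borel_measurable (unif_prod E)" "\<And>U. 0 \<le> X U \<and> X U \<le> 1"
      "\<And>U t. X (U(f := t)) = X U" "\<And>U t. X (U(g := t)) = X U"
    and Y: "Y \<in> borel_measurable (unif_prod E)" "\<And>U. 0 \<le> Y U \<and> Y U \<le> 1"
      "\<And>U t. Y (U(f := t)) = Y U" "\<And>U t. Y (U(g := t)) = Y U"
  shows "(\<integral>U. min (clip_ratio (X U) (U f)) (clip_ratio (Y U) (U g)) \<partial>unif_prod E)
    = (\<integral>U. 1 - (X U + Y U) / 2 + X U * Y U / 3 \<partial>unif_prod E)"
proof -
  interpret unif: prob_space unif by (rule prob_space_unif)
  define c where "c U = clip_ratio (Y U) (U g)" for U
  have c01: "0 \<le> c U" "c U \<le> 1" for U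
    unfolding c_def using Y(2)[of U] by (auto simp: clip_ratio_nonneg clip_ratio_le_1)
  note coord = measurable_coordinate[OF E(2)] measurable_coordinate[OF E(3)]
  have cm: "c \<in> borel_measurable (unif_prod E)"
    unfolding c_def[abs_def] by (intro clip_ratio_measurable Y(1) coord)
  have "(\<integral>U. min (clip_ratio (X U) (U f)) (c U) \<partial>unif_prod E)
      = (\<integral>U. (\<integral>t. min (clip_ratio (X (U(f := t))) ((U(f := t)) f)) (c (U(f := t))) \<partial>unif) \<partial>unif_prod E)"
  proof (rule resample[OF E(1,2), where B = 1])
    show "\<bar>min (clip_ratio (X U) (U f)) (c U)\<bar> \<le> 1" for U
      using c01[of U] clip_ratio_nonneg[of "X U" "U f"] by (simp add: min_def)
    show "(\<lambda>U. min (clip_ratio (X U) (U f)) (c U)) \<in> borel_measurable (unif_prod E)"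
      by (intro borel_measurable_min clip_ratio_measurable X(1) coord cm)
  qed
  also have "\<dots> = (\<integral>U. c U - X U * (c U)\<^sup>2 / 2 \<partial>unif_prod E)"
  proof (rule Bochner_Integration.integral_cong[OF refl])
    fix U
    have "c (U(f := t)) = c U" for t using E(4) by (simp add: c_def Y(3))
    then show "(\<integral>t. min (clip_ratio (X (U(f := t))) ((U(f := t)) f)) (c (U(f := t))) \<partial>unif)
        = c U - X U * (c U)\<^sup>2 / 2"
      using X(2)[of U] c01 by (simp add: X(3) integral_min_clip_ratio)
  qed
  also have "\<dots> = (\<integral>U. (\<integral>t. c (U(g := t)) - X (U(g := t)) * (c (U(g := t)))\<^sup>2 / 2 \<partial>unif) \<partial>unif_prod E)"
  proof (rule resample[OF E(1,3), where B = 2])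
    show "\<bar>c U - X U * (c U)\<^sup>2 / 2\<bar> \<le> 2" for U
    proof -
      have "0 \<le> X U * (c U)\<^sup>2" "X U * (c U)\<^sup>2 \<le> 1"
        using X(2)[of U] c01[of U] by (simp_all add: mult_le_one power_le_one)
      then show ?thesis using c01[of U] by (simp add: abs_le_iff)
    qed
    show "(\<lambda>U. c U - X U * (c U)\<^sup>2 / 2) \<in> borel_measurable (unif_prod E)"
      by (intro borel_measurable_diff borel_measurable_divide borel_measurable_times
          borel_measurable_power borel_measurable_const X(1) cm)
  qed
  also have "\<dots> = (\<integral>U. 1 - (X U + Y U) / 2 + X U * Y U / 3 \<partial>unif_prod E)"
  proof (rule Bochner_Integration.integral_cong[OF refl])
    fix U
    have Y01: "0 \<le> Y U" "Y U \<le> 1" using Y(2)[of U] by auto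
    have *: "\<bar>clip_ratio (Y U) t\<bar> \<le> 1" for t
      using Y01 by (simp add: clip_ratio_nonneg clip_ratio_le_1)
    have int: "integrable unif (\<lambda>t. clip_ratio (Y U) t)" "integrable unif (\<lambda>t. (clip_ratio (Y U) t)\<^sup>2)"
      by (auto intro!: unif.integrable_const_bound[of _ 1] simp: * abs_square_le_1)
    have "(\<integral>t. c (U(g := t)) - X (U(g := t)) * (c (U(g := t)))\<^sup>2 / 2 \<partial>unif)
        = (\<integral>t. clip_ratio (Y U) t - X U / 2 * (clip_ratio (Y U) t)\<^sup>2 \<partial>unif)"
      by (simp add: c_def X(4) Y(4))
    also have "\<dots> = (1 - Y U / 2) - X U / 2 * (1 - 2 * Y U / 3)"
      using int Y01 by (simp add: integral_clip_ratio integral_clip_ratio_square)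
    finally show "(\<integral>t. c (U(g := t)) - X (U(g := t)) * (c (U(g := t)))\<^sup>2 / 2 \<partial>unif)
        = 1 - (X U + Y U) / 2 + X U * Y U / 3"
      by (simp add: field_simps)
  qed
  finally show ?thesis by (simp add: c_def)
qed

section \<open>Contraction of the gap\<close>

lemma cavity_bound_update:
  assumes "f \<notin> F" shows "cavity_bound n b F v (U(f := t)) = cavity_bound n b F v U"
  using assms by (intro cavity_bound_cong) auto

lemma expect_coordinate_deficit:
  assumes E: "finite E" "f \<in> E" and c: "0 \<le> c" "c \<le> 1"
  shows "(\<integral>U. min 1 (max 0 (c - U f)) \<partial>unif_prod E) = c\<^sup>2 / 2"
proof -
  interpret prob_space "unif_prod E" by (rule prob_space_unif_prod)
  have "(\<integral>U. min 1 (max 0 (c - U f)) \<partial>unif_prod E)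
      = (\<integral>U. (\<integral>t. min 1 (max 0 (c - (U(f := t)) f)) \<partial>unif) \<partial>unif_prod E)"
  proof (rule resample[OF E, where B = 1])
    show "(\<lambda>U. min 1 (max 0 (c - U f))) \<in> borel_measurable (unif_prod E)"
      by (intro borel_measurable_min borel_measurable_max borel_measurable_diff
          borel_measurable_const measurable_coordinate E)
  qed (simp add: min_def max_def)
  then show ?thesis using c by (simp add: integral_deficit prob_space)
qed

text \<open>The minimum is attained at 1, where the deficit vanishes, or at a child, where
  \<open>clip_ratio_ge\<close> bounds the deficit by that child's summand.\<close>

lemma cavity_bound_True_deficit_le:
  assumes fin: "finite F" and c: "c \<le> 1"
  shows "max 0 (c - cavity_bound n True F u U) \<le> (\<Sum>x\<in>nbrs F u. min 1 (max 0 (c - U {u, x})))"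
proof (cases n)
  case 0
  then show ?thesis using c by (simp add: sum_nonneg)
next
  case (Suc m)
  let ?S = "(\<lambda>x. clip_ratio (cavity_bound m False (edges_avoiding {u} F) x U) (U {u, x})) ` nbrs F u"
  have "cavity_bound n True F u U \<in> insert 1 ?S"
    unfolding Suc cavity_bound.simps not_True_eq_False using finite_nbrs[OF fin] by (intro Min_in) auto
  then consider "cavity_bound n True F u U = 1"
    | x where "x \<in> nbrs F u"
      "cavity_bound n True F u U = clip_ratio (cavity_bound m False (edges_avoiding {u} F) x U) (U {u, x})"
    by blast
  then show ?thesis
  proof cases
    case 1
    then show ?thesis using c by (simp add: sum_nonneg)
  next
    case 2
    have fd: "finite (edges_avoiding {u} F)" by (rule finite_subset[OF edges_avoiding_subset fin])
    have "min 1 (U {u, x}) \<le> cavity_bound n True F u U"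
      unfolding 2(2) using cavity_bound_bounds[OF fd] by (intro clip_ratio_ge) auto
    moreover have "0 \<le> cavity_bound n True F u U"
      using cavity_bound_bounds[OF fin] by blast
    ultimately have "max 0 (c - cavity_bound n True F u U) \<le> min 1 (max 0 (c - U {u, x}))"
      using c by linarith
    also have "\<dots> \<le> (\<Sum>x\<in>nbrs F u. min 1 (max 0 (c - U {u, x})))"
      using 2(1) finite_nbrs[OF fin]
      by (intro member_le_sum[where f = "\<lambda>x. min 1 (max 0 (c - U {u, x}))"]) auto
    finally show ?thesis .
  qed
qed

text \<open>Each of the at most two neighbours contributes c^2 / 2 by linearity.\<close>

lemma expected_deficit:
  assumes E: "finite E" "F \<subseteq> E" and deg: "card (nbrs F u) \<le> 2" and c: "0 \<le> c" "c \<le> 1"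
  shows "(\<integral>U. max 0 (c - cavity_bound n True F u U) \<partial>unif_prod E) \<le> c\<^sup>2"
proof -
  have fin: "finite F" using E finite_subset by blast
  have edge: "{u, x} \<in> E" if "x \<in> nbrs F u" for x using that E by (auto simp: nbrs_def)
  have int1: "integrable (unif_prod E) (\<lambda>U. max 0 (c - cavity_bound n True F u U))"
  proof (rule integrable_unif_prod[where B = 1])
    show "\<bar>max 0 (c - cavity_bound n True F u U)\<bar> \<le> 1" for U
      using c cavity_bound_bounds[OF fin, of n True u U] by linarith
  qed (intro borel_measurable_max borel_measurable_diff borel_measurable_const
        cavity_bound_measurable E)
  have int2: "integrable (unif_prod E) (\<lambda>U. min 1 (max 0 (c - U {u, x})))" if "x \<in> nbrs F u" for x
    by (rule integrable_unif_prod[where B = 1])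
      (intro borel_measurable_min borel_measurable_max borel_measurable_diff
        borel_measurable_const measurable_coordinate edge that, linarith)
  have "(\<integral>U. max 0 (c - cavity_bound n True F u U) \<partial>unif_prod E)
      \<le> (\<integral>U. (\<Sum>x\<in>nbrs F u. min 1 (max 0 (c - U {u, x}))) \<partial>unif_prod E)"
    using int1 int2 cavity_bound_True_deficit_le[OF fin c(2)]
    by (intro integral_mono Bochner_Integration.integrable_sum)
  also have "\<dots> = (\<Sum>x\<in>nbrs F u. \<integral>U. min 1 (max 0 (c - U {u, x})) \<partial>unif_prod E)"
    using int2 by (rule Bochner_Integration.integral_sum)
  also have "\<dots> = card (nbrs F u) * (c\<^sup>2 / 2)"
    using edge by (simp add: expect_coordinate_deficit[OF E(1) _ c])
  also have "\<dots> \<le> 2 * (c\<^sup>2 / 2)"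
    using deg by (intro mult_right_mono) auto
  finally show ?thesis by simp
qed

text \<open>With d_i = y_i - x_i, averaging the two ways of splitting y_1 y_2 - x_1 x_2 shows that
  it is at least (d_1 y_2 + d_2 y_1) / 2. The level 3 \<epsilon> cancels the factor 1/3 and leaves a
  gain of \<epsilon> / 2 per child.\<close>

lemma two_child_gap_le:
  fixes x1 x2 y1 y2 :: real
  assumes "0 \<le> x1" "x1 \<le> y1" "y1 \<le> 1" "0 \<le> x2" "x2 \<le> y2" "y2 \<le> 1"
  shows "(1 - (x1 + x2) / 2 + x1 * x2 / 3) - (1 - (y1 + y2) / 2 + y1 * y2 / 3)
    \<le> (1 - \<epsilon>) / 2 * (y1 - x1) + (1 - \<epsilon>) / 2 * (y2 - x2)
       + max 0 (3 * \<epsilon> - y1) / 6 + max 0 (3 * \<epsilon> - y2) / 6"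
proof -
  \<comment> \<open>Replaces a product of possibly dependent quantities by a linear term and a
    deficit, whose expectations can be bounded separately.\<close>
  have *: "3 * \<epsilon> * d - max 0 (3 * \<epsilon> - y) \<le> d * y" if "0 \<le> d" "d \<le> 1" for d y :: real
  proof -
    have "d * (3 * \<epsilon> - y) \<le> d * max 0 (3 * \<epsilon> - y)"
      using that by (intro mult_left_mono) auto
    also have "\<dots> \<le> max 0 (3 * \<epsilon> - y)"
      using that by (simp add: mult_left_le_one_le)
    finally show ?thesis by (simp add: algebra_simps)
  qed
  have "0 \<le> x1 * (y2 - x2)" "0 \<le> x2 * (y1 - x1)"
    using assms by auto
  moreover have "3 * \<epsilon> * (y1 - x1) - max 0 (3 * \<epsilon> - y2) \<le> (y1 - x1) * y2"
    "3 * \<epsilon> * (y2 - x2) - max 0 (3 * \<epsilon> - y1) \<le> (y2 - x2) * y1"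
    using assms by (auto intro!: *)
  ultimately show ?thesis
    by (simp add: field_simps)
qed

abbreviation cavity_gap :: "nat \<Rightarrow> 'a set set \<Rightarrow> 'a \<Rightarrow> ('a set \<Rightarrow> real) \<Rightarrow> real" where
  "cavity_gap n F v U \<equiv> cavity_bound n True F v U - cavity_bound n False F v U"

lemma integrable_surv_bound:
  assumes "finite E" "F \<subseteq> E" shows "integrable (unif_prod E) (cavity_bound n b F v)"
  using cavity_bound_bounds[OF finite_subset[OF assms(2,1)], of n b v] cavity_bound_measurable[OF assms]
  by (intro integrable_unif_prod[where B = 1]) auto

text \<open>Without children the gap vanishes, with one it halves, with two
  \<open>two_child_gap_le\<close> is integrated. The condition \<epsilon> \<le> 1/3 makes 3
  \<epsilon> an admissible deficit level and ensures 1/2 \<le> 1 - \<epsilon>.\<close>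

lemma expected_gap_Suc:
  assumes E: "finite E" "F \<subseteq> E" and F: "simple_edges F"
    and deg: "card (nbrs F v) \<le> 2" "\<And>x. x \<in> nbrs F v \<Longrightarrow> card (nbrs (edges_avoiding {v} F) x) \<le> 2"
    and \<epsilon>: "0 < \<epsilon>" "\<epsilon> \<le> 1 / 3"
    and D: "0 \<le> D" "\<And>x. x \<in> nbrs F v \<Longrightarrow> (\<integral>U. cavity_gap n (edges_avoiding {v} F) x U \<partial>unif_prod E) \<le> D"
  shows "(\<integral>U. cavity_gap (Suc n) F v U \<partial>unif_prod E) \<le> (1 - \<epsilon>) * D + 3 * \<epsilon>\<^sup>2"
proof -
  interpret prob_space "unif_prod E" by (rule prob_space_unif_prod)
  define s where "s b x U = cavity_bound n b (edges_avoiding {v} F) x U" for b x U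
  have DE: "edges_avoiding {v} F \<subseteq> E" using E edges_avoiding_subset by blast
  have fd: "finite (edges_avoiding {v} F)" using finite_subset[OF DE E(1)] .
  have fn: "finite (nbrs F v)" using finite_nbrs[OF simple_edges_finite[OF F]] .
  have s01: "0 \<le> s b x U \<and> s b x U \<le> 1" for b x U
    unfolding s_def by (rule cavity_bound_bounds[OF fd])
  have s_le: "s False x U \<le> s True x U" for x U
    unfolding s_def by (rule cavity_bound_mono[OF fd])
  have sm: "s b x \<in> borel_measurable (unif_prod E)" for b x
    unfolding s_def[abs_def] by (rule cavity_bound_measurable[OF E(1) DE])
  have si: "integrable (unif_prod E) (s b x)" for b x
    using s01 sm by (intro integrable_unif_prod[where B = 1]) auto
  \<comment> \<open>The children's bounds live in the graph without \<open>v\<close>, so they never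
    read an edge at \<open>v\<close>.\<close>
  have su: "s b x (U({v, y} := t)) = s b x U" for b x y U t
    unfolding s_def by (intro cavity_bound_update) (simp add: edges_avoiding_def)
  have edge: "{v, x} \<in> E" if "x \<in> nbrs F v" for x using that E by (auto simp: nbrs_def)
  have gapD: "expectation (s True x) - expectation (s False x) \<le> D" if "x \<in> nbrs F v" for x
    using D(2)[OF that] si by (simp add: s_def[abs_def])
  have split: "(\<integral>U. cavity_gap (Suc n) F v U \<partial>unif_prod E)
      = expectation (cavity_bound (Suc n) True F v) - expectation (cavity_bound (Suc n) False F v)"
    by (intro Bochner_Integration.integral_diff integrable_surv_bound E)
  have goal0: "0 \<le> (1 - \<epsilon>) * D + 3 * \<epsilon>\<^sup>2" using D \<epsilon> by simp
  have "card (nbrs F v) = 0 \<or> card (nbrs F v) = 1 \<or> card (nbrs F v) = 2" using deg(1) by linarith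
  then consider "nbrs F v = {}" | x where "nbrs F v = {x}" | x y where "x \<noteq> y" "nbrs F v = {x, y}"
    using fn by (auto simp: card_1_singleton_iff card_2_iff)
  then show ?thesis
  proof cases
    case 1
    then show ?thesis using goal0 by simp
  next
    case (2 x)
    have eq: "cavity_bound (Suc n) b F v = (\<lambda>U. clip_ratio (s (\<not> b) x U) (U {v, x}))" for b
      using s01[of "\<not> b" x] by (simp add: fun_eq_iff 2 s_def[symmetric] min_absorb2 clip_ratio_le_1)
    have ex: "expectation (cavity_bound (Suc n) b F v) = 1 - expectation (s (\<not> b) x) / 2" for b
      unfolding eq using edge[of x] 2 si
      by (subst expect_clip_ratio[OF E(1) _ sm s01 su]) (auto simp: prob_space)
    have "(\<integral>U. cavity_gap (Suc n) F v U \<partial>unif_prod E) \<le> (1 / 2) * D"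
      unfolding split ex using gapD[of x] 2 by simp
    also have "\<dots> \<le> (1 - \<epsilon>) * D" using \<epsilon> D by (intro mult_right_mono) auto
    finally show ?thesis by (simp add: add_increasing2)
  next
    case (3 x y)
    let ?q = "\<lambda>b U. 1 - (s b x U + s b y U) / 2 + s b x U * s b y U / 3"
    let ?m = "\<lambda>x U. max 0 (3 * \<epsilon> - s True x U)"
    have eq: "cavity_bound (Suc n) b F v
        = (\<lambda>U. min (clip_ratio (s (\<not> b) x U) (U {v, x})) (clip_ratio (s (\<not> b) y U) (U {v, y})))" for b
      using s01[of "\<not> b" x] s01[of "\<not> b" y]
      by (simp add: fun_eq_iff 3 s_def[symmetric] min_absorb2 clip_ratio_le_1 min.coboundedI1)
    have ex: "expectation (cavity_bound (Suc n) b F v) = expectation (?q (\<not> b))" for b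
      unfolding eq using edge[of x] edge[of y] 3
      by (intro expect_min_clip_ratio[OF E(1) _ _ _ sm s01 su su sm s01 su su])
        (auto simp: doubleton_eq_iff)
    have qi: "integrable (unif_prod E) (?q b)" for b
    proof (rule integrable_unif_prod[where B = 3])
      show "\<bar>?q b U\<bar> \<le> 3" for U
      proof -
        have "0 \<le> s b x U * s b y U" "s b x U * s b y U \<le> 1"
          using s01[of b x U] s01[of b y U] by (simp_all add: mult_le_one)
        moreover have "\<bar>1 - (p + q) / 2 + m / 3\<bar> \<le> 3"
          if "0 \<le> m" "m \<le> 1" "0 \<le> p \<and> p \<le> 1" "0 \<le> q \<and> q \<le> 1" for p q m :: real
          using that by (simp add: abs_le_iff field_simps)
        ultimately show ?thesis using s01 by blast
      qed
    qed (intro borel_measurable_add borel_measurable_diff borel_measurable_divide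
        borel_measurable_times borel_measurable_const sm)
    have mi: "integrable (unif_prod E) (?m x)" for x
    proof (rule integrable_unif_prod[where B = 1])
      show "\<bar>?m x U\<bar> \<le> 1" for U
        using s01[of True x U] \<epsilon> by linarith
    qed (intro borel_measurable_max borel_measurable_diff borel_measurable_const sm)
    have me: "expectation (?m x) \<le> (3 * \<epsilon>)\<^sup>2" if "x \<in> nbrs F v" for x
      unfolding s_def using \<epsilon> by (intro expected_deficit E(1) DE deg(2) that) auto
    \<comment> \<open>The upper bound comes from the children's lower bounds, hence
      \<open>?q False\<close> is the minuend.\<close>
    have "(\<integral>U. cavity_gap (Suc n) F v U \<partial>unif_prod E) = expectation (\<lambda>U. ?q False U - ?q True U)"
      unfolding split ex using Bochner_Integration.integral_diff[OF qi qi] by simp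
    also have "\<dots> \<le> expectation (\<lambda>U. (1 - \<epsilon>) / 2 * (s True x U - s False x U)
        + (1 - \<epsilon>) / 2 * (s True y U - s False y U) + ?m x U / 6 + ?m y U / 6)"
      using s01 s_le
      by (intro integral_mono Bochner_Integration.integrable_diff Bochner_Integration.integrable_add
          integrable_mult_right integrable_divide qi si mi two_child_gap_le) auto
    also have "\<dots> = (1 - \<epsilon>) / 2 * (expectation (s True x) - expectation (s False x))
        + (1 - \<epsilon>) / 2 * (expectation (s True y) - expectation (s False y))
        + expectation (?m x) / 6 + expectation (?m y) / 6"
      using si mi by simp
    \<comment> \<open>\<open>expected_deficit\<close> at level 3 \<epsilon> bounds each deficit by 9
      \<epsilon>^2; two of them over 6 make 3 \<epsilon>^2.\<close>
    also have "\<dots> \<le> (1 - \<epsilon>) / 2 * D + (1 - \<epsilon>) / 2 * D + (3 * \<epsilon>)\<^sup>2 / 6 + (3 * \<epsilon>)\<^sup>2 / 6"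
      using gapD me 3 \<epsilon> by (intro add_mono mult_left_mono divide_right_mono) auto
    finally show ?thesis by (simp add: power_mult_distrib field_simps)
  qed
qed

text \<open>A child loses its parent \<open>v\<close> as a neighbour. This keeps the branching at
  two in a graph of maximum degree three.\<close>

lemma card_nbrs_avoiding:
  assumes F: "simple_edges F" and deg: "card (nbrs F x) \<le> Suc d" and x: "x \<in> nbrs F v"
  shows "card (nbrs (edges_avoiding {v} F) x) \<le> d"
proof -
  have fn: "finite (nbrs F x)" by (rule finite_nbrs[OF simple_edges_finite[OF F]])
  have "nbrs (edges_avoiding {v} F) x \<subseteq> nbrs F x - {v}" by (auto simp: nbrs_def edges_avoiding_def)
  then have "card (nbrs (edges_avoiding {v} F) x) \<le> card (nbrs F x - {v})" using fn by (intro card_mono) auto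
  moreover have "v \<in> nbrs F x" using x by (simp add: nbrs_def insert_commute)
  ultimately show ?thesis using deg fn by simp
qed

text \<open>Induction on the affine recursion: 3 \<epsilon> is the fixed point of t \<mapsto> (1 -
  \<epsilon>) t + 3 \<epsilon>^2, and the initial gap is 1.\<close>

lemma expected_gap_le:
  assumes "finite E" "F \<subseteq> E" "simple_edges F"
    and "card (nbrs F v) \<le> 2" "\<And>x. card (nbrs F x) \<le> 3"
    and \<epsilon>: "0 < \<epsilon>" "\<epsilon> \<le> 1 / 3"
  shows "(\<integral>U. cavity_gap n F v U \<partial>unif_prod E) \<le> (1 - \<epsilon>) ^ n + 3 * \<epsilon>"
  using assms(2-5)
proof (induction n arbitrary: F v)
  case 0
  interpret prob_space "unif_prod E" by (rule prob_space_unif_prod)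
  show ?case using \<epsilon> by (simp add: prob_space)
next
  case (Suc n)
  have "(\<integral>U. cavity_gap (Suc n) F v U \<partial>unif_prod E)
      \<le> (1 - \<epsilon>) * ((1 - \<epsilon>) ^ n + 3 * \<epsilon>) + 3 * \<epsilon>\<^sup>2"
  proof (rule expected_gap_Suc[OF assms(1) Suc.prems(1-3) _ \<epsilon>])
    show "0 \<le> (1 - \<epsilon>) ^ n + 3 * \<epsilon>" using \<epsilon> by simp
    fix x assume x: "x \<in> nbrs F v"
    show d2: "card (nbrs (edges_avoiding {v} F) x) \<le> 2"
      using card_nbrs_avoiding[OF Suc.prems(2) _ x, of 2] Suc.prems(4) by simp
    have "card (nbrs (edges_avoiding {v} F) y) \<le> card (nbrs F y)" for y
      by (intro card_mono finite_nbrs nbrs_mono edges_avoiding_subset simple_edges_finite Suc.prems(2))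
    then have "card (nbrs (edges_avoiding {v} F) y) \<le> 3" for y
      using Suc.prems(4) order_trans by blast
    then show "(\<integral>U. cavity_gap n (edges_avoiding {v} F) x U \<partial>unif_prod E) \<le> (1 - \<epsilon>) ^ n + 3 * \<epsilon>"
      using d2 by (intro Suc.IH simple_edges_avoiding subset_trans[OF edges_avoiding_subset] Suc.prems(1,2))
  qed
  also have "\<dots> = (1 - \<epsilon>) ^ Suc n + 3 * \<epsilon>" by (simp add: algebra_simps power2_eq_square)
  finally show ?case .
qed

section \<open>Balls around an edge\<close>

lemma graph_dist_le_iff:
  "graph_dist G u v \<le> enat k \<longleftrightarrow> (\<exists>p. is_walk G u p v \<and> length p \<le> Suc k)"
proof
  assume le: "graph_dist G u v \<le> enat k"
  let ?S = "(\<lambda>p. enat (length p - 1)) ` {p. is_walk G u p v}"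
  \<comment> \<open>A finite distance excludes the empty set of walks, whose infimum is \<infinity>;
    over a nonempty set of \<open>enat\<close> values the infimum is attained.\<close>
  have "?S \<noteq> {}" using le by (auto simp: graph_dist_def Inf_enat_def split: if_splits)
  then have "graph_dist G u v \<in> ?S"
    unfolding graph_dist_def Inf_enat_def by (auto intro: LeastI)
  with le show "\<exists>p. is_walk G u p v \<and> length p \<le> Suc k" by auto
next
  assume "\<exists>p. is_walk G u p v \<and> length p \<le> Suc k"
  then obtain p where p: "is_walk G u p v" "length p \<le> Suc k" by blast
  have "graph_dist G u v \<le> enat (length p - 1)"
    unfolding graph_dist_def using p(1) by (intro INF_lower) simp
  also have "\<dots> \<le> enat k" using p(2) by simp
  finally show "graph_dist G u v \<le> enat k" .
qed

definition ball_verts :: "'a ugraph \<Rightarrow> 'a set \<Rightarrow> nat \<Rightarrow> 'a set" where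
  "ball_verts G e k = {x \<in> verts G. \<exists>u\<in>e. graph_dist G u x \<le> enat k}"

lemma ball_verts_iff:
  "x \<in> ball_verts G e k \<longleftrightarrow> x \<in> verts G \<and> (\<exists>u\<in>e. \<exists>p. is_walk G u p x \<and> length p \<le> Suc k)"
  by (simp add: ball_verts_def graph_dist_le_iff)

lemma ball_verts_mono: "j \<le> k \<Longrightarrow> ball_verts G e j \<subseteq> ball_verts G e k"
  unfolding ball_verts_iff subset_iff by (meson Suc_le_mono order_trans)

lemma endpoint_in_ball_verts:
  assumes "u \<in> e" "u \<in> verts G" shows "u \<in> ball_verts G e 0"
proof -
  have "is_walk G u [u] u" using assms by (simp add: is_walk_def)
  then show ?thesis using assms unfolding ball_verts_iff by force
qed

lemma edge_ends_in_verts: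
  assumes "is_graph G" "{x, y} \<in> edges G" shows "x \<in> verts G" "y \<in> verts G"
  using assms unfolding is_graph_def by (metis doubleton_eq_iff)+

lemma ball_verts_step:
  assumes G: "is_graph G" and xy: "{x, y} \<in> edges G" and x: "x \<in> ball_verts G e k"
  shows "y \<in> ball_verts G e (Suc k)"
proof -
  obtain u p where p: "u \<in> e" "is_walk G u p x" "length p \<le> Suc k"
    using x by (auto simp: ball_verts_iff)
  then have "is_walk G u (p @ [y]) y"
    using xy edge_ends_in_verts[OF G xy] by (auto simp: is_walk_def successively_append_iff adj_def)
  with p edge_ends_in_verts[OF G xy] show ?thesis
    unfolding ball_verts_iff by (metis Suc_le_mono length_append_singleton)
qed

lemma ball_verts_Suc_subset:
  "ball_verts G e (Suc k) \<subseteq> ball_verts G e k \<union> (\<Union>y\<in>ball_verts G e k. neighbors G y)"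
proof
  fix x assume x: "x \<in> ball_verts G e (Suc k)"
  then obtain u p where p: "u \<in> e" "is_walk G u p x" "length p \<le> Suc (Suc k)"
    by (auto simp: ball_verts_iff)
  have xv: "x \<in> verts G" using x by (simp add: ball_verts_iff)
  show "x \<in> ball_verts G e k \<union> (\<Union>y\<in>ball_verts G e k. neighbors G y)"
  proof (cases "length p \<le> Suc k")
    case True
    then show ?thesis using p xv by (auto simp: ball_verts_iff)
  next
    case False
    obtain q where q: "p = q @ [x]"
      using p(2) by (metis append_butlast_last_id is_walk_def)
    with False have "q \<noteq> []" by auto
    then have "is_walk G u q (last q)" "adj G (last q) x" "last q \<in> verts G"
      using p(2) q by (auto simp: is_walk_def successively_append_iff)
    moreover have "length q \<le> Suc k" using q p(3) by simp
    ultimately have "last q \<in> ball_verts G e k" "adj G (last q) x"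
      using p(1) unfolding ball_verts_iff by blast+
    then show ?thesis
      using xv by (auto simp: neighbors_def)
  qed
qed

lemma finite_ball_verts:
  assumes "max_degree_le G d" "finite e"
  shows "finite (ball_verts G e k)"
proof (induction k)
  case 0
  have "ball_verts G e 0 \<subseteq> e"
  proof
    fix x assume "x \<in> ball_verts G e 0"
    then obtain u p where "u \<in> e" "is_walk G u p x" "length p \<le> Suc 0"
      by (auto simp: ball_verts_iff)
    moreover from this have "p = [u]" "x = u" by (cases p; auto simp: is_walk_def)+
    ultimately show "x \<in> e" by simp
  qed
  then show ?case using assms(2) finite_subset by blast
next
  case (Suc k)
  have "finite (neighbors G y)" if "y \<in> ball_verts G e k" for y
    using that assms(1) by (simp add: max_degree_le_def ball_verts_def)
  with Suc show ?case
    by (intro finite_subset[OF ball_verts_Suc_subset]) simp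
qed

text \<open>A boundary vertex has a neighbour outside the ball, whereas all neighbours of a vertex
  within distance k < r lie within distance r.\<close>

lemma boundary_edge_ball_disjoint:
  assumes G: "is_graph G" and k: "k < r"
  shows "boundary G (edge_ball G e r) \<inter> ball_verts G e k = {}"
proof -
  have vb: "verts (edge_ball G e r) = ball_verts G e r"
    by (auto simp: edge_ball_def induced_subgraph_def ball_verts_def)
  {
    fix v assume "v \<in> boundary G (edge_ball G e r)" "v \<in> ball_verts G e k"
    then obtain u where "u \<notin> ball_verts G e r" "u \<in> ball_verts G e (Suc k)"
      using ball_verts_step[OF G] by (auto simp: boundary_def vb adj_def)
    then have False using ball_verts_mono[of "Suc k" r G e] k by auto
  }
  then show ?thesis by blast
qed

lemma simple_edges_edge_ball:
  assumes "is_graph G" "max_degree_le G d" "finite e"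
  shows "simple_edges (edges (edge_ball G e r))"
proof -
  have "edges (edge_ball G e r) \<subseteq> Pow (ball_verts G e r)"
    by (auto simp: edge_ball_def induced_subgraph_def ball_verts_def)
  then have "finite (edges (edge_ball G e r))"
    using finite_ball_verts[OF assms(2,3)] finite_subset by blast
  then show ?thesis
    using assms(1) unfolding simple_edges_def is_graph_def edge_ball_def induced_subgraph_def
    by fastforce
qed

lemma edges_delete_verts_edge_ball:
  "edges (delete_verts (edge_ball G e r) A) = edges_avoiding A (edges (edge_ball G e r))"
  by (auto simp: delete_verts_def edge_ball_def induced_subgraph_def edges_avoiding_def)

lemma card_nbrs_le:
  assumes G: "is_graph G" and d: "max_degree_le G d" and F: "F \<subseteq> edges G"
  shows "card (nbrs F x) \<le> d"
\<comment> \<open>The degree bound speaks only of vertices of \<open>G\<close>; a neighbour in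
  \<open>F\<close> certifies that \<open>x\<close> is one.\<close>
proof (cases "nbrs F x = {}")
  case False
  then obtain y where "{x, y} \<in> edges G" using F by (auto simp: nbrs_def)
  then have "x \<in> verts G" using edge_ends_in_verts[OF G] by blast
  then have *: "finite (neighbors G x)" "card (neighbors G x) \<le> d" 
    using d by (auto simp: max_degree_le_def)
  moreover have "nbrs F x \<subseteq> neighbors G x"
    using F edge_ends_in_verts[OF G] by (auto simp: nbrs_def neighbors_def adj_def)
  ultimately show ?thesis using card_mono order_trans by blast
qed simp

section \<open>Law of the transformed edge weights\<close>

lemma distr_exp_uminus_exponential:
  assumes "prob_space P" and D: "distributed P lborel X (exponential_density 1)"
  shows "distr P borel (\<lambda>\<omega>. exp (- X \<omega>)) = unif"
proof -
  interpret prob_space P by fact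
  have Xm: "X \<in> borel_measurable P" using distributed_measurable[OF D] by simp
  have Ym: "(\<lambda>\<omega>. exp (- X \<omega>)) \<in> borel_measurable P" using Xm by measurable
  have "\<P>(\<omega> in P. exp (- X \<omega>) \<le> t) = t" if t: "0 \<le> t" "t \<le> 1" for t
  proof (cases "t = 0")
    case True
    then show ?thesis by (simp add: not_le[symmetric])
  next
    case False
    then have t0: "0 < t" using t by simp
    have iff: "exp (- x) \<le> t \<longleftrightarrow> - ln t \<le> x" for x
      using t0 by (metis exp_le_cancel_iff exp_ln minus_le_iff)
    \<comment> \<open>The tail formula for the exponential law is strict, so the null event of
      equality must be discarded.\<close>
    have "AE \<omega> in P. X \<omega> \<noteq> - ln t"
      using AE_lborel_singleton[of "- ln t"]
      by (subst distributed_AE2[OF D]) (auto elim: eventually_mono)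
    then have "AE \<omega> in P. \<omega> \<in> {\<omega> \<in> space P. exp (- X \<omega>) \<le> t} \<longleftrightarrow> \<omega> \<in> {\<omega> \<in> space P. - ln t < X \<omega>}"
    proof eventually_elim
      case (elim \<omega>)
      then show ?case unfolding iff by (auto simp: less_le)
    qed
    then have "\<P>(\<omega> in P. exp (- X \<omega>) \<le> t) = \<P>(\<omega> in P. - ln t < X \<omega>)"
      by (rule measure_eq_AE) (use Xm in measurable)
    also have "\<dots> = t"
      using exponential_distributedD_gt[OF D, of "- ln t"] t0 t by simp
    finally show ?thesis .
  qed
  then have "distributed P lborel (\<lambda>\<omega>. exp (- X \<omega>)) (\<lambda>x. indicator {0..1} x / measure lborel {0..1::real})"
    using Ym by (subst uniform_distributed_iff) auto
  from distributed_distr_eq_density[OF this]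
  have "distr P borel (\<lambda>\<omega>. exp (- X \<omega>)) = density lborel (\<lambda>x. ennreal (indicator {0..1} x / measure lborel {0..1::real}))"
    by (simp add: distr_cong[OF refl sets_lborel[symmetric] refl])
  also have "\<dots> = unif"
    unfolding uniform_measure_def by (rule density_cong) (auto split: split_indicator)
  finally show ?thesis .
qed

text \<open>Independence as a product law. Restricting to \<open>E\<close> makes the vector
  extensional, as points of a product space are.\<close>

lemma distr_exp_uminus_family:
  assumes P: "prob_space P" and E: "E \<noteq> {}"
    and ind: "prob_space.indep_vars P (\<lambda>_. borel) w E"
    and D: "\<And>f. f \<in> E \<Longrightarrow> distributed P lborel (w f) (exponential_density 1)"
  shows "(\<lambda>\<omega>. \<lambda>f\<in>E. exp (- w f \<omega>)) \<in> measurable P (unif_prod E)"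
    and "distr P (unif_prod E) (\<lambda>\<omega>. \<lambda>f\<in>E. exp (- w f \<omega>)) = unif_prod E"
proof -
  interpret prob_space P by fact
  have wm: "w f \<in> borel_measurable P" if "f \<in> E" for f
    using distributed_measurable[OF D[OF that]] by simp
  have rv: "(\<lambda>\<omega>. exp (- w f \<omega>)) \<in> borel_measurable P" if "f \<in> E" for f
    using wm[OF that] by measurable
  have sets: "sets (unif_prod E) = sets (Pi\<^sub>M E (\<lambda>_. borel))"
    by (intro sets_PiM_cong) auto
  show "(\<lambda>\<omega>. \<lambda>f\<in>E. exp (- w f \<omega>)) \<in> measurable P (unif_prod E)"
    using rv by (intro measurable_restrict) simp
  have "indep_vars (\<lambda>_. borel) (\<lambda>f \<omega>. exp (- w f \<omega>)) E"
    by (rule indep_vars_compose2[OF ind]) measurable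
  then have "distr P (Pi\<^sub>M E (\<lambda>_. borel)) (\<lambda>\<omega>. \<lambda>f\<in>E. exp (- w f \<omega>))
      = Pi\<^sub>M E (\<lambda>f. distr P borel (\<lambda>\<omega>. exp (- w f \<omega>)))"
    by (subst (asm) indep_vars_iff_distr_eq_PiM'[OF E]) (use rv in auto)
  also have "\<dots> = unif_prod E"
    using D distr_exp_uminus_exponential[OF P] by (intro PiM_cong) auto
  finally show "distr P (unif_prod E) (\<lambda>\<omega>. \<lambda>f\<in>E. exp (- w f \<omega>)) = unif_prod E"
    using distr_cong[OF refl sets refl] by metis
qed

section \<open>The correlation decay bound\<close>

text \<open>\<open>L\<close> and \<open>H\<close> are unaffected by the coordinate \<open>f\<close>,
  so integrating it out first yields the length of the interval.\<close>

lemma expect_between: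
  assumes E: "finite E" "f \<in> E"
    and L: "L \<in> borel_measurable (unif_prod E)" "\<And>U t. L (U(f := t)) = L U" "\<And>U. 0 \<le> L U"
    and H: "H \<in> borel_measurable (unif_prod E)" "\<And>U t. H (U(f := t)) = H U" "\<And>U. H U \<le> 1"
    and LH: "\<And>U. L U \<le> H U"
  shows "(\<lambda>U. of_bool (L U \<le> U f \<and> U f \<le> H U) :: real) \<in> borel_measurable (unif_prod E)" (is ?meas)
    and "(\<integral>U. (of_bool (L U \<le> U f \<and> U f \<le> H U) :: real) \<partial>unif_prod E) = (\<integral>U. H U - L U \<partial>unif_prod E)"
proof -
  show meas: ?meas
  proof -
    have "{U \<in> space (unif_prod E). L U \<le> U f \<and> U f \<le> H U} \<in> sets (unif_prod E)"
      by (intro sets.sets_Collect_conj borel_measurable_le L(1) H(1) measurable_coordinate E(2))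
    from borel_measurable_indicator[OF this, where ?'b = real] show ?thesis
      by (rule measurable_cong[THEN iffD1, rotated]) (auto split: split_indicator)
  qed
  have "(\<integral>U. (of_bool (L U \<le> U f \<and> U f \<le> H U) :: real) \<partial>unif_prod E)
      = (\<integral>U. (\<integral>t. of_bool (L (U(f := t)) \<le> (U(f := t)) f \<and> (U(f := t)) f \<le> H (U(f := t))) \<partial>unif)
          \<partial>unif_prod E)"
    by (rule resample[OF E meas, where B = 1]) simp
  also have "\<dots> = (\<integral>U. H U - L U \<partial>unif_prod E)"
    by (simp only: L(2) H(2) fun_upd_same integral_between[OF L(3) LH H(3)])
  finally show "(\<integral>U. (of_bool (L U \<le> U f \<and> U f \<le> H U) :: real) \<partial>unif_prod E)
      = (\<integral>U. H U - L U \<partial>unif_prod E)" .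
qed

text \<open>The supremum is at most the indicator that the uniform variable of \<open>e\<close> lies
  between two products. The factor 2 counts the ends of \<open>e\<close>, each contributing one
  gap.\<close>

lemma rho_le:
  fixes G :: "'a ugraph" and P :: "'b measure"
  assumes G: "is_graph G" "max_degree_le G 3" and P: "prob_space P"
    and ind: "prob_space.indep_vars P (\<lambda>_. borel) w (edges G)"
    and D: "\<And>f. f \<in> edges G \<Longrightarrow> distributed P lborel (w f) (exponential_density 1)"
    and e: "e \<in> edges G" and r: "1 \<le> r" and \<epsilon>: "0 < \<epsilon>" "\<epsilon> \<le> 1 / 3"
  shows "rho P w G e r \<le> 2 * ((1 - \<epsilon>) ^ r + 3 * \<epsilon>)"
proof -
  interpret prob_space P by fact
  obtain a b where ab: "a \<noteq> b" "e = {a, b}" "a \<in> verts G" "b \<in> verts G"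
    using e G(1) unfolding is_graph_def by blast
  define E where "E = edges (edge_ball G e r)"
  define F where "F = E - {e}"
  define Z where "Z \<omega> = (\<lambda>f\<in>E. exp (- w f \<omega>))" for \<omega>
  \<comment> \<open>\<open>L\<close> and \<open>H\<close> bracket the product of cavities that
    decides whether \<open>e\<close> is used; the factor at \<open>b\<close> is taken after deleting
    \<open>a\<close>.\<close>
  define L where "L U = cavity_bound r False F a U * cavity_bound r False (edges_avoiding {a} F) b U" for U
  define H where "H U = cavity_bound r True F a U * cavity_bound r True (edges_avoiding {a} F) b U" for U
  have sE: "simple_edges E" unfolding E_def using G ab by (intro simple_edges_edge_ball) auto
  have EG: "E \<subseteq> edges G" by (auto simp: E_def edge_ball_def induced_subgraph_def)
  have "{a, b} \<subseteq> ball_verts G e r"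
    using endpoint_in_ball_verts[of _ e G] ball_verts_mono[of 0 r G e] ab by auto
  then have eE: "e \<in> E"
    using e ab by (auto simp: E_def edge_ball_def induced_subgraph_def ball_verts_def)
  have fE: "finite E" using sE by (rule simple_edges_finite)
  have FE: "F \<subseteq> E" "edges_avoiding {a} F \<subseteq> E" using edges_avoiding_subset[of "{a}" F] by (auto simp: F_def)
  have sF: "simple_edges F" "simple_edges (edges_avoiding {a} F)"
    using simple_edges_subset[OF sE] FE by auto
  have fF: "finite F" "finite (edges_avoiding {a} F)" using sF by (simp_all add: simple_edges_finite)

  have deg3: "card (nbrs F' x) \<le> 3" if "F' \<subseteq> E" for F' x
    using that EG by (intro card_nbrs_le[OF G]) auto
  \<comment> \<open>Removing \<open>e\<close> costs each of its ends one neighbour, so the recursion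
    starts with at most two children.\<close>
  have deg2F: "card (nbrs F x) \<le> 2" if xy: "e = {x, y}" for x y
  proof -
    have "y \<in> nbrs E x" "y \<notin> nbrs F x" using eE by (simp_all add: nbrs_def F_def xy)
    then have "nbrs F x \<subset> nbrs E x" using nbrs_mono[OF FE(1), of x] by blast
    then show ?thesis
      using psubset_card_mono[OF finite_nbrs[OF fE], of "nbrs F x" x] deg3[of E x] by simp
  qed
  have "card (nbrs (edges_avoiding {a} F) b) \<le> card (nbrs F b)"
    by (intro card_mono finite_nbrs fF nbrs_mono edges_avoiding_subset)
  then have deg2: "card (nbrs F a) \<le> 2" "card (nbrs (edges_avoiding {a} F) b) \<le> 2"
    using deg2F[of a b] deg2F[of b a] ab(2) by (simp_all add: insert_commute)

  have gap_bounds: "0 \<le> cavity_bound r B F' x U" "cavity_bound r B F' x U \<le> 1"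
      "cavity_bound r False F' x U \<le> cavity_bound r True F' x U" if "finite F'" for B F' x U
    using cavity_bound_bounds[OF that] cavity_bound_mono[OF that] by auto
  note bd = gap_bounds[OF fF(1)] gap_bounds[OF fF(2)]
  have LH: "L U \<le> H U" for U
    unfolding L_def H_def by (intro mult_mono bd)
  have L0: "0 \<le> L U" for U unfolding L_def by (intro mult_nonneg_nonneg bd)
  have H1: "H U \<le> 1" for U unfolding H_def by (intro mult_le_one bd)
  have LHm: "L \<in> borel_measurable (unif_prod E)" "H \<in> borel_measurable (unif_prod E)"
    unfolding L_def[abs_def] H_def[abs_def]
    by (intro borel_measurable_times cavity_bound_measurable fE FE)+
  have eF: "e \<notin> F" "e \<notin> edges_avoiding {a} F" using edges_avoiding_subset[of "{a}" F] by (auto simp: F_def)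
  have LHu: "L (U(e := t)) = L U" "H (U(e := t)) = H U" for U t
    unfolding L_def H_def by (simp_all only: cavity_bound_update[OF eF(1)] cavity_bound_update[OF eF(2)])
  note between = expect_between[OF fE eE LHm(1) LHu(1) L0 LHm(2) LHu(2) H1 LH]

  define S where "S \<omega> = (SUP A\<in>Pow (boundary G (edge_ball G e r)).
      \<bar>of_bool (e \<in> max_weight_matching (edge_ball G e r) (\<lambda>f. w f \<omega>))
        - of_bool (e \<in> max_weight_matching (delete_verts (edge_ball G e r) A) (\<lambda>f. w f \<omega>)) :: real\<bar>)"
    for \<omega>
  define T where "T U = (of_bool (L U \<le> U e \<and> U e \<le> H U) :: real)" for U
  have S_le: "S \<omega> \<le> T (Z \<omega>)" for \<omega>
    unfolding S_def
  proof (rule cSUP_least)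
    let ?U = "\<lambda>f. exp (- w f \<omega>)"
    let ?B = "edge_ball G e r"
    have LHZ: "L (Z \<omega>) = L ?U" "H (Z \<omega>) = H ?U"
      unfolding L_def H_def using FE
      by (auto intro!: arg_cong2[where f = "(*)"] cavity_bound_cong simp: Z_def)
    have status: "(exp (- w e \<omega>) < L ?U \<longrightarrow> e \<in> max_weight_matching (delete_verts ?B A) (\<lambda>f. w f \<omega>)) \<and>
        (H ?U < exp (- w e \<omega>) \<longrightarrow> e \<notin> max_weight_matching (delete_verts ?B A) (\<lambda>f. w f \<omega>))"
      if A: "A \<subseteq> boundary G ?B" for A
    proof -
      let ?w = "\<lambda>f. w f \<omega>"
      let ?D = "delete_verts ?B A"
      have eD: "edges ?D = edges_avoiding A E" by (simp add: edges_delete_verts_edge_ball E_def)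
      have FA: "edges ?D - {e} = edges_avoiding A F" by (auto simp: eD edges_avoiding_def F_def)
      have FA': "edges_avoiding {a} (edges_avoiding A F) = edges_avoiding A (edges_avoiding {a} F)" by (simp add: edges_avoiding_avoiding Un_commute)
      have disj: "A \<inter> ball_verts G e k = {}" if "k < r" for k
        using boundary_edge_ball_disjoint[OF G(1) that, of e] A by blast
      \<comment> \<open>As \<open>r \<ge> 1\<close>, the boundary misses both ends of
        \<open>e\<close>, so \<open>e\<close> survives the deletion.\<close>
      have "e \<inter> A = {}"
        using disj[of 0] r ab endpoint_in_ball_verts[of _ e G] by auto
      then have eD': "e \<in> edges ?D" using eE by (simp add: eD edges_avoiding_def)
      have step: "y \<in> ball_verts G e (Suc k)" if "x \<in> ball_verts G e k" "{x, y} \<in> F'" "F' \<subseteq> E" for k x y F'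
        using that EG by (intro ball_verts_step[OF G(1)]) auto
      \<comment> \<open>Both ends lie in the ball of radius 0, so depth \<open>r\<close> is allowed;
        the resulting bounds do not mention \<open>A\<close>.\<close>
      have 1: "cavity_bound r False F a ?U \<le> cavity ?w (edges_avoiding A F) a \<and>
          cavity ?w (edges_avoiding A F) a \<le> cavity_bound r True F a ?U"
        by (rule cavity_sandwich[where B = "ball_verts G e" and k = 0 and r = r])
          (use sF disj step FE ab endpoint_in_ball_verts[of a e G] in auto)
      have 2: "cavity_bound r False (edges_avoiding {a} F) b ?U \<le> cavity ?w (edges_avoiding A (edges_avoiding {a} F)) b \<and>
          cavity ?w (edges_avoiding A (edges_avoiding {a} F)) b \<le> cavity_bound r True (edges_avoiding {a} F) b ?U"
        by (rule cavity_sandwich[where B = "ball_verts G e" and k = 0 and r = r])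
          (use sF disj step FE ab endpoint_in_ball_verts[of b e G] in auto)
      let ?p = "cavity ?w (edges_avoiding A F) a * cavity ?w (edges_avoiding A (edges_avoiding {a} F)) b"
      have p: "L ?U \<le> ?p" "?p \<le> H ?U"
        unfolding L_def H_def using 1 2 cavity_pos[THEN less_imp_le] bd by (auto intro!: mult_mono)
      have sD: "simple_edges (edges ?D)" unfolding eD by (rule simple_edges_avoiding[OF sE])
      note m = edge_in_max_weight_matching[OF sD ab(2,1) eD', of ?w, unfolded FA FA']
      show ?thesis using m p by (meson less_le_trans le_less_trans)
    qed
    \<comment> \<open>The intact ball is the case of deleting nothing, so \<open>status\<close> also
      covers the first indicator.\<close>
    have B: "max_weight_matching ?B (\<lambda>f. w f \<omega>) = max_weight_matching (delete_verts ?B {}) (\<lambda>f. w f \<omega>)"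
      unfolding max_weight_matching_def matchings_def edges_delete_verts_edge_ball
      by (simp add: edges_avoiding_def)
    fix A assume "A \<in> Pow (boundary G ?B)"
    then have A: "A \<subseteq> boundary G ?B" by simp
    have Ze: "Z \<omega> e = exp (- w e \<omega>)" using eE by (simp add: Z_def)
    show "\<bar>of_bool (e \<in> max_weight_matching ?B (\<lambda>f. w f \<omega>))
        - of_bool (e \<in> max_weight_matching (delete_verts ?B A) (\<lambda>f. w f \<omega>)) :: real\<bar> \<le> T (Z \<omega>)"
      using status[OF A] status[of "{}"] unfolding B T_def LHZ Ze by (auto simp: not_le)
  qed auto

  have Z: "Z \<in> measurable P (unif_prod E)" "distr P (unif_prod E) Z = unif_prod E"
    unfolding Z_def[abs_def] using eE EG D
    by (auto intro!: distr_exp_uminus_family P indep_vars_subset[OF ind])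
  have Tm: "T \<in> borel_measurable (unif_prod E)"
    unfolding T_def[abs_def] by (rule between(1))
  have T_int: "integrable P (\<lambda>\<omega>. T (Z \<omega>))"
    using measurable_compose[OF Z(1) Tm] by (intro integrable_const_bound[of _ 1]) (auto simp: T_def)
  have gi: "integrable (unif_prod E) (cavity_gap r F a)" "integrable (unif_prod E) (cavity_gap r (edges_avoiding {a} F) b)"
    by (intro Bochner_Integration.integrable_diff integrable_surv_bound fE FE)+
  have HL_int: "integrable (unif_prod E) (\<lambda>U. H U - L U)"
  proof (rule integrable_unif_prod[where B = 1])
    show "\<bar>H U - L U\<bar> \<le> 1" for U using L0[of U] H1[of U] LH[of U] by linarith
  qed (intro borel_measurable_diff LHm)
  have HL: "H U - L U \<le> cavity_gap r F a U + cavity_gap r (edges_avoiding {a} F) b U" for U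
  proof -
    \<comment> \<open>From x y - x' y' = (x - x') y + x' (y - y').\<close>
    have "x * y - x' * y' \<le> (x - x') + (y - y')"
      if "0 \<le> x'" "x' \<le> x" "x \<le> 1" "0 \<le> y'" "y' \<le> y" "y \<le> 1" for x x' y y' :: real
    proof -
      have "(x - x') * y \<le> x - x'" "x' * (y - y') \<le> y - y'"
        using that by (simp_all add: mult_left_le mult_left_le_one_le)
      then show ?thesis by (simp add: algebra_simps)
    qed
    then show ?thesis unfolding H_def L_def using bd by simp
  qed
  have bound0: "0 \<le> 2 * ((1 - \<epsilon>) ^ r + 3 * \<epsilon>)" using \<epsilon> by simp
  have rho: "rho P w G e r = expectation S"
    unfolding rho_def S_def[abs_def] ..
  show ?thesis
  \<comment> \<open>If \<open>S\<close> were not integrable, its expectation would be 0 by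
    convention, below the nonnegative bound.\<close>
  proof (cases "integrable P S")
    case True
    have "expectation S \<le> expectation (\<lambda>\<omega>. T (Z \<omega>))"
      using True T_int S_le by (rule integral_mono)
    also have "\<dots> = (\<integral>U. T U \<partial>unif_prod E)"
      using integral_distr[OF Z(1) Tm] by (simp add: Z(2))
    also have "\<dots> = (\<integral>U. H U - L U \<partial>unif_prod E)"
      unfolding T_def by (rule between(2))
    also have "\<dots> \<le> (\<integral>U. cavity_gap r F a U + cavity_gap r (edges_avoiding {a} F) b U \<partial>unif_prod E)"
      by (intro integral_mono HL_int HL Bochner_Integration.integrable_add gi)
    also have "\<dots> = (\<integral>U. cavity_gap r F a U \<partial>unif_prod E) + (\<integral>U. cavity_gap r (edges_avoiding {a} F) b U \<partial>unif_prod E)"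
      by (intro Bochner_Integration.integral_add gi)
    also have "\<dots> \<le> ((1 - \<epsilon>) ^ r + 3 * \<epsilon>) + ((1 - \<epsilon>) ^ r + 3 * \<epsilon>)"
      using FE by (intro add_mono expected_gap_le fE sF deg2 deg3 \<epsilon>) auto
    finally show ?thesis by (simp add: rho)
  next
    case False
    show ?thesis using bound0 unfolding rho not_integrable_integral_eq[OF False] .
  qed
qed

section \<open>The trivial bound and the choice of \<epsilon>\<close>

lemma rho_le_1:
  assumes "prob_space P" shows "rho P w G e r \<le> 1"
proof -
  interpret prob_space P by fact
  define S where "S \<omega> = (SUP A\<in>Pow (boundary G (edge_ball G e r)).
      \<bar>of_bool (e \<in> max_weight_matching (edge_ball G e r) (\<lambda>f. w f \<omega>))
        - of_bool (e \<in> max_weight_matching (delete_verts (edge_ball G e r) A) (\<lambda>f. w f \<omega>)) :: real\<bar>)"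
    for \<omega>
  have "S \<omega> \<le> 1" for \<omega> unfolding S_def by (rule cSUP_least) auto
  then have "expectation S \<le> 1"
    by (cases "integrable P S") (auto intro: integral_le_const simp: not_integrable_integral_eq)
  then show ?thesis unfolding rho_def S_def[abs_def] .
qed

text \<open>By 1 - x \<le> exp (- x) the power is at most 1 / r, and ln r \<ge> 1/2 turns this into
  2 ln r / r; the total is 6 times 3.\<close>

lemma log_choice_bound:
  assumes r: "2 \<le> (r::nat)"
  shows "0 < ln r / r" "ln r / r < 1" "6 * ((1 - ln r / r) ^ r + ln r / r) \<le> 18 * ln r / r"
proof -
  have r0: "0 < real r" using r by simp
  show pos: "0 < ln r / r" using r by simp
  show lt: "ln r / r < 1" using ln_less_self[OF r0] r0 by simp
  have "(1 - ln r / r) ^ r \<le> exp (- (ln r / r)) ^ r"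
    using lt exp_ge_add_one_self[of "- (ln r / r)"] by (intro power_mono) auto
  also have "\<dots> = exp (- ln r)"
    using r0 by (simp add: exp_of_nat_mult[symmetric])
  also have "\<dots> = 1 / r"
    using r0 by (simp add: exp_minus inverse_eq_divide)
  finally have *: "(1 - ln r / r) ^ r \<le> 1 / r" .
  have "1 / 2 \<le> ln (2::real)" using ln2_ge_two_thirds by simp
  also have "\<dots> \<le> ln r" using r by simp
  finally have "1 / r \<le> 2 * (ln r / r)"
    using r0 by (simp add: field_simps)
  with * show "6 * ((1 - ln r / r) ^ r + ln r / r) \<le> 18 * ln r / r" by simp
qed

theorem theorem1p4:
  fixes G :: "'a ugraph" and e :: "'a set"
    and P :: "'b measure" and w :: "'a set \<Rightarrow> 'b \<Rightarrow> real"
  assumes "is_graph G" and "connected_graph G" and "max_degree_le G 3"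
    and "prob_space P"
    and "prob_space.indep_vars P (\<lambda>_. borel) w (edges G)"
    and "\<And>f. f \<in> edges G \<Longrightarrow> distributed P lborel (w f) (exponential_density 1)"
    and "e \<in> edges G"
  shows "(\<forall>r::nat. \<forall>\<epsilon>::real. r \<ge> 1 \<longrightarrow> 0 < \<epsilon> \<longrightarrow> \<epsilon> < 1 \<longrightarrow>
            rho P w G e r \<le> 6 * ((1 - \<epsilon>) ^ r + \<epsilon>))
       \<and> (\<forall>r::nat. r \<ge> 2 \<longrightarrow> rho P w G e r \<le> 18 * ln (real r) / real r)"
proof -
  have main: "rho P w G e r \<le> 6 * ((1 - \<epsilon>) ^ r + \<epsilon>)"
    if r: "r \<ge> 1" and \<epsilon>: "0 < \<epsilon>" "\<epsilon> < 1" for r :: nat and \<epsilon> :: real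
  \<comment> \<open>For larger \<epsilon> the right-hand side exceeds 2, so the trivial bound
    suffices.\<close>
  proof (cases "\<epsilon> \<le> 1 / 3")
    case True
    have "rho P w G e r \<le> 2 * ((1 - \<epsilon>) ^ r + 3 * \<epsilon>)"
      using assms r \<epsilon>(1) True by (intro rho_le)
    also have "\<dots> \<le> 6 * ((1 - \<epsilon>) ^ r + \<epsilon>)" using \<epsilon> by simp
    finally show ?thesis .
  next
    case False
    have "rho P w G e r \<le> 1" by (rule rho_le_1[OF assms(4)])
    also have "\<dots> \<le> 6 * \<epsilon>" using False by simp
    also have "\<dots> \<le> 6 * ((1 - \<epsilon>) ^ r + \<epsilon>)" using \<epsilon> by simp
    finally show ?thesis .
  qed
  show ?thesis
  proof (intro conjI allI impI)
    fix r :: nat assume r: "r \<ge> 2"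
    have "rho P w G e r \<le> 6 * ((1 - ln r / r) ^ r + ln r / r)"
      using r log_choice_bound(1,2)[OF r] by (intro main) auto
    also have "\<dots> \<le> 18 * ln r / r" by (rule log_choice_bound(3)[OF r])
    finally show "rho P w G e r \<le> 18 * ln (real r) / real r" .
  qed (use main in auto)
qed

end
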